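(* Let $(\mathcal A,\mathbb E)$ be a $B$-valued probability space and $a,b\in\mathcal A$ free with $\mathbb E(a),\mathbb E(b)\in B^\times$. Then $$S_{ab}=S_b\cdot\big(S_a\circ(S_b^{-1}\cdot I\cdot S_b)\big).$$
   Context: $B$ is a unital algebra over a field $\mathbb K$ of characteristic zero. $\mathrm{Mult}[[B]]$: sequences $f=(f_n)_{n\ge0}$ of multilinear maps $f_n:B^n\to B$. Product $(f\cdot g)_n(x_1,\dots,x_n)=\sum_{k=0}^n f_k(x_1,\dots,x_k)g_{n-k}(x_{k+1},\dots,x_n)$; for $g_0=0$, composition $(f\circ g)_n(x_1,\dots,x_n)=\sum_{l\ge0}\sum_{k_1+\dots+k_l=n,k_i\ge1}f_l(g_{k_1}(x_1,\dots,x_{k_1}),\dots,g_{k_l}(x_{n-k_l+1},\dots,x_n))$; $I=(\delta_{n,1}\mathrm{id}_B)$; composition binds tighter than product; $S^{-1}$ is the multiplicative inverse. $G_B^{\mathrm{inv}}=\{f:f_0\in B^\times\}$, $G_B^I=\{I\cdot F:F\in G_B^{\mathrm{inv}}\}$ with $(I\cdot F)_n(x_1,\dots,x_n)=x_1F_{n-1}(x_2,\dots,x_n)$. For $f\in G_B^I$, $f$ has a compositional inverse in $G_B^I$ and its S-transform $S_f\in G_B^{\mathrm{inv}}$ is defined by $f^{\circ-1}=I\cdot S_f$. $B$-valued probability space $(\mathcal A,\mathbb E)$: $\mathcal A$ a unital $\mathbb K$-algebra and $B$-bimodule with all mixed triple products associative, $\mathbb E:\mathcal A\to B$ linear, unital,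 $\mathbb E(xay)=x\mathbb E(a)y$ ($x,y\in B$). Freeness of $a,b$: for the $B$-subalgebras $\mathcal A_1,\mathcal A_2$ they generate, $\mathbb E(a_1\cdots a_n)=0$ whenever $n\ge1$, each $\mathbb E(a_i)=0$, $a_i\in\mathcal A_{j_i}$, $j_i\neq j_{i+1}$. Cumulants: with planar binary trees $Y_n$ ($Y_0=\{|\}$, $Y_n=\{\sigma\vee\tau:|\sigma|+|\tau|=n-1\}$), each $\tau\in Y_n$ ($n\ge1$) uniquely $\tau=\tau_1\vee(\tau_2\vee(\cdots\vee(\tau_k\vee|)))$, $j_i=|\tau_1|+\dots+|\tau_i|+i$, multilinear $\kappa_n:\mathcal A^n\to B$ are defined by $\mathbb E(a_1\cdots a_n)=\sum_{\tau\in Y_n}\kappa_\tau(a_1,\dots,a_n)$, $\kappa_|=1$, $\kappa_\tau(a_1,\dots,a_n)=\kappa_k(\kappa_{\tau_1}(a_1,\dots,a_{j_1-1})a_{j_1},\dots,\kappa_{\tau_k}(a_{j_{k-1}+1},\dots,a_{j_k-1})a_{j_k})$. For $a\in\mathcal A$: $k^a_0=0$, $k^a_n(x_1,\dots,x_n)=\kappa_n(x_1a,\dots,x_na)$; when $\mathbb E(a)\in B^\times$, $k^a\in G_B^I$ and $S_a:=S_{k^a}$. *)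

theory Defs
  imports Main
begin

definition bunit :: "'b::ring_1 \<Rightarrow> bool" where
  "bunit x \<longleftrightarrow> (\<exists>y. x * y = 1 \<and> y * x = 1)"

section \<open>Mult[[B]]: sequences f n :: B^n \<rightarrow> B, represented on lists of length n
  (values on lists of other lengths are irrelevant; the operations below return 0 there)\<close>

type_synonym 'b mseq = "nat \<Rightarrow> 'b list \<Rightarrow> 'b"

definition normalized :: "'b::zero mseq \<Rightarrow> bool" where
  "normalized f \<longleftrightarrow> (\<forall>n xs. length xs \<noteq> n \<longrightarrow> f n xs = 0)"

definition seq_eq :: "'b mseq \<Rightarrow> 'b mseq \<Rightarrow> bool" where
  "seq_eq f g \<longleftrightarrow> (\<forall>n xs. length xs = n \<longrightarrow> f n xs = g n xs)"

definition mone :: "'b::ring_1 mseq" where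
  "mone n xs = (if n = 0 \<and> xs = [] then 1 else 0)"

definition mI :: "'b::ring_1 mseq" where
  "mI n xs = (if n = 1 \<and> length xs = 1 then hd xs else 0)"

definition mprod :: "'b::ring_1 mseq \<Rightarrow> 'b mseq \<Rightarrow> 'b mseq" where
  "mprod f g n xs = (if length xs = n
     then (\<Sum>k\<le>n. f k (take k xs) * g (n - k) (drop k xs)) else 0)"

fun splits :: "nat list \<Rightarrow> 'x list \<Rightarrow> 'x list list" where
  "splits [] xs = []"
| "splits (k # ks) xs = take k xs # splits ks (drop k xs)"

definition compositions :: "nat \<Rightarrow> nat list set" where
  "compositions n = {ks. 0 \<notin> set ks \<and> sum_list ks = n}"

definition mcomp :: "'b::ring_1 mseq \<Rightarrow> 'b mseq \<Rightarrow> 'b mseq" where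
  "mcomp f g n xs = (if length xs = n
     then (\<Sum>ks\<in>compositions n.
             f (length ks) (map (\<lambda>(k, ys). g k ys) (zip ks (splits ks xs))))
     else 0)"

definition minv :: "'b::ring_1 mseq \<Rightarrow> 'b mseq" where
  "minv f = (THE h. normalized h \<and> seq_eq (mprod f h) mone \<and> seq_eq (mprod h f) mone)"

definition in_Ginv :: "'b::ring_1 mseq \<Rightarrow> bool" where
  "in_Ginv f \<longleftrightarrow> bunit (f 0 [])"

definition in_GI :: "'b::ring_1 mseq \<Rightarrow> bool" where
  "in_GI f \<longleftrightarrow> normalized f \<and> f 0 [] = 0 \<and>
     (\<exists>F. in_Ginv F \<and> (\<forall>n x xs. length xs = n \<longrightarrow> f (Suc n) (x # xs) = x * F n xs))"

definition compinv :: "'b::ring_1 mseq \<Rightarrow> 'b mseq" where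
  "compinv f = (THE h. in_GI h \<and> seq_eq (mcomp f h) mI \<and> seq_eq (mcomp h f) mI)"

text \<open>S-transform: f^{\<circ>-1} = I \<cdot> S_f, i.e. (f^{\<circ>-1})_{n+1}(x,x_1..x_n) = x S_f n (x_1..x_n);
  evaluating at x = 1 gives S_f.\<close>
definition S_transform :: "'b::ring_1 mseq \<Rightarrow> 'b mseq" where
  "S_transform f n xs = compinv f (Suc n) (1 # xs)"

definition kalg :: "('k::field_char_0 \<Rightarrow> 'r::ring_1 \<Rightarrow> 'r) \<Rightarrow> bool" where
  "kalg sc \<longleftrightarrow>
     (\<forall>c x y. sc c (x + y) = sc c x + sc c y) \<and>
     (\<forall>c d x. sc (c + d) x = sc c x + sc d x) \<and>
     (\<forall>c d x. sc (c * d) x = sc c (sc d x)) \<and>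
     (\<forall>x. sc 1 x = x) \<and>
     (\<forall>c x y. sc c (x * y) = sc c x * y) \<and>
     (\<forall>c x y. sc c (x * y) = x * sc c y)"

definition bprob_space ::
  "('k::field_char_0 \<Rightarrow> 'b::ring_1 \<Rightarrow> 'b) \<Rightarrow> ('k \<Rightarrow> 'a::ring_1 \<Rightarrow> 'a) \<Rightarrow>
   ('b \<Rightarrow> 'a \<Rightarrow> 'a) \<Rightarrow> ('a \<Rightarrow> 'b \<Rightarrow> 'a) \<Rightarrow> ('a \<Rightarrow> 'b) \<Rightarrow> bool" where
  "bprob_space sB sA lact ract E \<longleftrightarrow>
     kalg sB \<and> kalg sA \<and>
     \<comment> \<open>B-bimodule structure on A (compatible with the K-vector space structure)\<close>
     (\<forall>x y u. lact (x + y) u = lact x u + lact y u) \<and>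
     (\<forall>x u v. lact x (u + v) = lact x u + lact x v) \<and>
     (\<forall>x y u. lact (x * y) u = lact x (lact y u)) \<and>
     (\<forall>u. lact 1 u = u) \<and>
     (\<forall>u x y. ract u (x + y) = ract u x + ract u y) \<and>
     (\<forall>u v x. ract (u + v) x = ract u x + ract v x) \<and>
     (\<forall>u x y. ract u (x * y) = ract (ract u x) y) \<and>
     (\<forall>u. ract u 1 = u) \<and>
     (\<forall>x u y. ract (lact x u) y = lact x (ract u y)) \<and>
     (\<forall>c x u. lact (sB c x) u = sA c (lact x u)) \<and>
     (\<forall>c x u. lact x (sA c u) = sA c (lact x u)) \<and>
     (\<forall>c x u. ract u (sB c x) = sA c (ract u x)) \<and>
     (\<forall>c x u. ract (sA c u) x = sA c (ract u x)) \<and>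
     \<comment> \<open>mixed triple products associative\<close>
     (\<forall>x u v. lact x u * v = lact x (u * v)) \<and>
     (\<forall>u x v. ract u x * v = u * lact x v) \<and>
     (\<forall>u v x. ract (u * v) x = u * ract v x) \<and>
     \<comment> \<open>conditional expectation\<close>
     (\<forall>u v. E (u + v) = E u + E v) \<and>
     (\<forall>c u. E (sA c u) = sB c (E u)) \<and>
     E 1 = 1 \<and>
     (\<forall>x u y. E (ract (lact x u) y) = x * E u * y)"

inductive_set balg :: "('k \<Rightarrow> 'a::ring_1 \<Rightarrow> 'a) \<Rightarrow> ('b \<Rightarrow> 'a \<Rightarrow> 'a) \<Rightarrow> ('a \<Rightarrow> 'b \<Rightarrow> 'a)
    \<Rightarrow> 'a \<Rightarrow> 'a set"
  for sA lact ract a where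
  gen: "a \<in> balg sA lact ract a"
| one: "1 \<in> balg sA lact ract a"
| add: "u \<in> balg sA lact ract a \<Longrightarrow> v \<in> balg sA lact ract a \<Longrightarrow> u + v \<in> balg sA lact ract a"
| mult: "u \<in> balg sA lact ract a \<Longrightarrow> v \<in> balg sA lact ract a \<Longrightarrow> u * v \<in> balg sA lact ract a"
| scal: "u \<in> balg sA lact ract a \<Longrightarrow> sA c u \<in> balg sA lact ract a"
| lmod: "u \<in> balg sA lact ract a \<Longrightarrow> lact x u \<in> balg sA lact ract a"
| rmod: "u \<in> balg sA lact ract a \<Longrightarrow> ract u x \<in> balg sA lact ract a"

definition free :: "('k \<Rightarrow> 'a::ring_1 \<Rightarrow> 'a) \<Rightarrow> ('b::ring_1 \<Rightarrow> 'a \<Rightarrow> 'a) \<Rightarrow> ('a \<Rightarrow> 'b \<Rightarrow> 'a)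
    \<Rightarrow> ('a \<Rightarrow> 'b) \<Rightarrow> 'a \<Rightarrow> 'a \<Rightarrow> bool" where
  "free sA lact ract E a b \<longleftrightarrow>
     (\<forall>(as :: 'a list) (js :: bool list). length as \<ge> 1 \<longrightarrow> length js = length as \<longrightarrow>
        (\<forall>i < length as. E (as ! i) = 0 \<and>
            as ! i \<in> balg sA lact ract (if js ! i then a else b)) \<longrightarrow>
        (\<forall>i. Suc i < length as \<longrightarrow> js ! i \<noteq> js ! Suc i) \<longrightarrow>
        E (prod_list as) = 0)"

datatype ptree = Leaf | Node ptree ptree

fun tsize :: "ptree \<Rightarrow> nat" where
  "tsize Leaf = 0"
| "tsize (Node l r) = tsize l + tsize r + 1"

fun spine :: "ptree \<Rightarrow> ptree list" where
  "spine Leaf = []"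
| "spine (Node l r) = l # spine r"

text \<open>kt kappa lact tau as = kappa_tau(a_1,...,a_n); kargs produces the arguments
  kappa_{tau_i}(a_{j_{i-1}+1},...,a_{j_i - 1}) a_{j_i} along the right spine.\<close>
fun kt :: "(nat \<Rightarrow> 'a::ring_1 list \<Rightarrow> 'b::ring_1) \<Rightarrow> ('b \<Rightarrow> 'a \<Rightarrow> 'a) \<Rightarrow> ptree \<Rightarrow> 'a list \<Rightarrow> 'b"
and kargs :: "(nat \<Rightarrow> 'a::ring_1 list \<Rightarrow> 'b::ring_1) \<Rightarrow> ('b \<Rightarrow> 'a \<Rightarrow> 'a) \<Rightarrow> ptree \<Rightarrow> 'a list \<Rightarrow> 'a list"
where
  "kt \<kappa> lact Leaf as = 1"
| "kt \<kappa> lact (Node l r) as =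
     \<kappa> (length (spine (Node l r)))
       (lact (kt \<kappa> lact l (take (tsize l) as)) (as ! tsize l)
         # kargs \<kappa> lact r (drop (tsize l + 1) as))"
| "kargs \<kappa> lact Leaf as = []"
| "kargs \<kappa> lact (Node l r) as =
     lact (kt \<kappa> lact l (take (tsize l) as)) (as ! tsize l)
       # kargs \<kappa> lact r (drop (tsize l + 1) as)"

text \<open>The cumulants kappa_n, n \<ge> 1, are determined by the moment-cumulant relation;
  kappa_0 never occurs and is normalised to 0, as are values on lists of wrong length.\<close>
definition cumulants :: "('b::ring_1 \<Rightarrow> 'a::ring_1 \<Rightarrow> 'a) \<Rightarrow> ('a \<Rightarrow> 'b) \<Rightarrow> (nat \<Rightarrow> 'a list \<Rightarrow> 'b)" where
  "cumulants lact E = (THE \<kappa>. (\<forall>as. \<kappa> 0 as = 0) \<and>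
      (\<forall>n as. length as \<noteq> n \<longrightarrow> \<kappa> n as = 0) \<and>
      (\<forall>n as. n \<ge> 1 \<longrightarrow> length as = n \<longrightarrow>
          E (prod_list as) = (\<Sum>\<tau>\<in>{\<tau>. tsize \<tau> = n}. kt \<kappa> lact \<tau> as)))"

definition kseq :: "('b::ring_1 \<Rightarrow> 'a::ring_1 \<Rightarrow> 'a) \<Rightarrow> ('a \<Rightarrow> 'b) \<Rightarrow> 'a \<Rightarrow> 'b mseq" where
  "kseq lact E a n xs = (if n = 0 then 0 else cumulants lact E n (map (\<lambda>x. lact x a) xs))"

definition S_el :: "('b::ring_1 \<Rightarrow> 'a::ring_1 \<Rightarrow> 'a) \<Rightarrow> ('a \<Rightarrow> 'b) \<Rightarrow> 'a \<Rightarrow> 'b mseq" where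
  "S_el lact E a = S_transform (kseq lact E a)"

end

theory Submission
  imports Defs
begin

text \<open>
Multilinear function series are functions on lists; with the deconcatenation product they form a
ring, in which \<open>z\<close> without constant term gives an invertible \<open>1 - z\<close>. The moment-cumulant
relation, evaluated at \<open>\<chi> = (1 + T)\<inverse> T S\<close> with \<open>T\<close> the formal variable, says that
\<open>k\<^sup>c \<circ> (T \<cdot> S) = T\<close> holds iff \<open>E((1 - \<chi> c)\<inverse>) = 1 + T\<close>, so the S-transform is characterised without
cumulants. Put \<open>s = S\<^sub>b\<close>, \<open>t = s\<inverse> T s\<close>, \<open>u = S\<^sub>a \<circ> t\<close>, \<open>p = (1 + T)\<inverse> T\<close>, \<open>A = s u a s\<inverse>\<close> and
\<open>C = s b\<close>. Substituting \<open>t\<close> and conjugating by \<open>s\<close> gives \<open>E((1 - p A)\<inverse>) = 1 + T = E((1 - p C)\<inverse>)\<close>.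
Freeness applied to the centred parts of these resolvents yields \<open>E((1 - p A C)\<inverse>) = 1 + T\<close>,
and \<open>A C = s u a b\<close>, so \<open>S\<^bsub>ab\<^esub> = s u\<close>.
\<close>

section \<open>Composition of functions on lists\<close>

text \<open>The moment-cumulant relation says that \<phi> = E((1 - \<chi> c)^-1) - 1 solves \<phi> =
  k^c \<circ> ((1 + \<phi>) \<chi>). Asking for \<phi> = T together with k^c \<circ> (T S) = T
  forces (1 + T) \<chi> = T S, which explains the choice of \<chi>. The obstacle is
  noncommutativity. The untwisted elements S_a a and s b both have the required resolvents, but in
  their product S_a a s b the factor s is caught between a and b, so the product is not a B-valued
  series times a b. Writing the first factor as A = s u a s^-1 lets s^-1 cancel against the s of C =
  s b. Conjugation acts on p as well: the resolvent of p A is the conjugate by s of the resolvent of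
  (s^-1 p s) u a, and s^-1 p s is p with T replaced by t = s^-1 T s. Hence a must be treated in the
  variable t, where the right series is u = S_a \<circ> t. This is the source of the twist in the
  formula.\<close>

definition conv :: "('x list \<Rightarrow> 'x list \<Rightarrow> 'z::comm_monoid_add) \<Rightarrow> 'x list \<Rightarrow> 'z" where
  "conv h xs = (\<Sum>k\<le>length xs. h (take k xs) (drop k xs))"

lemma conv_Nil [simp]: "conv h [] = h [] []"
  by (simp add: conv_def)

lemma conv_Cons: "conv h (x # xs) = h [] (x # xs) + conv (\<lambda>us. h (x # us)) xs"
  by (simp add: conv_def sum.atMost_Suc_shift del: sum.atMost_Suc)

lemma conv_cong:
  assumes "\<And>us vs. us @ vs = xs \<Longrightarrow> h us vs = h' us vs"
  shows "conv h xs = conv h' xs"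
  unfolding conv_def by (intro sum.cong refl assms) simp

lemma conv_add: "conv (\<lambda>us vs. h us vs + h' us vs) xs = conv h xs + conv h' xs"
  by (simp add: conv_def sum.distrib)

lemma conv_0 [simp]: "conv (\<lambda>us vs. 0) xs = 0"
  by (simp add: conv_def)

lemma additive_conv:
  assumes "L 0 = 0" "\<And>x y. L (x + y) = L x + L y"
  shows "L (conv h xs) = conv (\<lambda>us vs. L (h us vs)) xs"
  by (induction xs arbitrary: h) (simp_all add: conv_Cons assms)

text \<open>Both sides sum \<open>H\<close> over all ways to cut \<open>xs\<close> into three
  consecutive pieces.\<close>

lemma conv_assoc:
  "conv (\<lambda>ws vs. conv (\<lambda>us us'. H us us' vs) ws) xs = conv (\<lambda>us ws. conv (H us) ws) xs"
proof (induction xs arbitrary: H)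
  case (Cons x xs)
  show ?case
    using Cons.IH[of "\<lambda>us. H (x # us)"] by (simp add: conv_Cons conv_add add.assoc)
qed simp

text \<open>The block containing the first entry is split off and its value is absorbed into
  \<open>f\<close>. Inductions thus run over the list with \<open>f\<close> arbitrary, and no index
  set of compositions appears. Blocks are nonempty, so \<open>g []\<close> is never
  evaluated.\<close>

fun lcomp :: "('y list \<Rightarrow> 'z::comm_monoid_add) \<Rightarrow> ('x list \<Rightarrow> 'y) \<Rightarrow> 'x list \<Rightarrow> 'z" where
  "lcomp f g [] = f []"
| "lcomp f g (x # xs) = (\<Sum>k\<le>length xs. lcomp (\<lambda>ys. f (g (x # take k xs) # ys)) g (drop k xs))"

lemma lcomp_Cons: "lcomp f g (x # xs) = conv (\<lambda>us. lcomp (\<lambda>ys. f (g (x # us) # ys)) g) xs"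
  by (simp add: conv_def)

declare lcomp.simps(2) [simp del]

lemma lcomp_induct [case_names Nil Cons]:
  assumes "P []" "\<And>x xs. (\<And>ys. length ys \<le> length xs \<Longrightarrow> P ys) \<Longrightarrow> P (x # xs)"
  shows "P xs"
proof (induction xs rule: length_induct)
  case (1 xs)
  then show ?case using assms by (cases xs) (auto simp: less_Suc_eq_le)
qed

lemma lcomp_cong:
  assumes "\<And>ys. ys \<noteq> [] \<Longrightarrow> length ys \<le> length xs \<Longrightarrow> g ys = g' ys"
    and "\<And>ys. length ys \<le> length xs \<Longrightarrow> f ys = f' ys"
  shows "lcomp f g xs = lcomp f' g' xs"
  using assms
proof (induction xs arbitrary: f f' rule: lcomp_induct)
  case (Cons x xs)
  have "lcomp (\<lambda>ys. f (g (x # us) # ys)) g vs = lcomp (\<lambda>ys. f' (g' (x # us) # ys)) g' vs"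
    if "us @ vs = xs" for us vs
    using that by (intro Cons.IH) (auto simp: Cons.prems)
  then show ?case unfolding lcomp_Cons by (intro conv_cong)
qed simp

lemma lcomp_additive:
  assumes "L 0 = 0" "\<And>x y. L (x + y) = L x + L y"
  shows "L (lcomp f g xs) = lcomp (\<lambda>ys. L (f ys)) g xs"
proof (induction xs arbitrary: f rule: lcomp_induct)
  case (Cons x xs)
  then show ?case
    by (auto simp: lcomp_Cons additive_conv[of L, OF assms] intro!: conv_cong)
qed simp

lemma lcomp_add: "lcomp (\<lambda>ys. f ys + f' ys) g xs = lcomp f g xs + lcomp f' g xs"
proof (induction xs arbitrary: f f' rule: lcomp_induct)
  case (Cons x xs)
  then show ?case
    by (auto simp: lcomp_Cons conv_add[symmetric] intro!: conv_cong)
qed simp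

lemma lcomp_zero [simp]: "lcomp (\<lambda>ys. 0 :: 'z::comm_monoid_add) g xs = 0"
proof (induction xs rule: lcomp_induct)
  case (Cons x xs)
  have "lcomp (\<lambda>ys. 0 :: 'z) g (x # xs) = conv (\<lambda>us vs. 0) xs"
    unfolding lcomp_Cons by (intro conv_cong Cons.IH) auto
  then show ?case by simp
qed simp

lemma lcomp_map: "lcomp f (\<lambda>xs. \<phi> (g xs)) xs = lcomp (\<lambda>ys. f (map \<phi> ys)) g xs"
proof (induction xs arbitrary: f rule: lcomp_induct)
  case (Cons x xs)
  then show ?case by (auto simp: lcomp_Cons intro!: conv_cong)
qed simp

text \<open>A cut between two blocks is a cut of the input list, so cutting the list of block values
  amounts to cutting the input and forming blocks on either side. This makes substitution
  multiplicative in the outer series.\<close>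

lemma lcomp_conv:
  "lcomp (conv K) h xs = conv (\<lambda>us vs. lcomp (\<lambda>ps. lcomp (K ps) h vs) h us) xs"
proof (induction xs arbitrary: K rule: lcomp_induct)
  case (Cons x xs)
  have "lcomp (conv K) h (x # xs) =
      conv (\<lambda>us vs. lcomp (\<lambda>ys. K [] (h (x # us) # ys)) h vs
        + lcomp (conv (\<lambda>ps. K (h (x # us) # ps))) h vs) xs"
    unfolding lcomp_Cons by (intro conv_cong) (simp add: conv_Cons lcomp_add)
  also have "\<dots> = lcomp (K []) h (x # xs)
      + conv (\<lambda>us vs. lcomp (conv (\<lambda>ps. K (h (x # us) # ps))) h vs) xs"
    by (simp add: conv_add lcomp_Cons)
  also have "conv (\<lambda>us vs. lcomp (conv (\<lambda>ps. K (h (x # us) # ps))) h vs) xs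
      = conv (\<lambda>us vs. conv (\<lambda>vs1 vs2. lcomp (\<lambda>ps. lcomp (K (h (x # us) # ps)) h vs2) h vs1) vs) xs"
    by (auto intro!: conv_cong Cons.IH)
  also have "\<dots> = conv (\<lambda>ws vs. lcomp (\<lambda>ps. lcomp (K ps) h vs) h (x # ws)) xs"
    unfolding lcomp_Cons by (rule conv_assoc[symmetric])
  finally show ?case by (simp add: conv_Cons)
qed simp

text \<open>\<open>sum_at xs ys zs\<close>: the three lists agree except at one position, where \<open>zs\<close> holds the sum.\<close>
inductive sum_at :: "'x::plus list \<Rightarrow> 'x list \<Rightarrow> 'x list \<Rightarrow> bool" where
  here: "sum_at (x # l) (y # l) ((x + y) # l)"
| there: "sum_at xs ys zs \<Longrightarrow> sum_at (c # xs) (c # ys) (c # zs)"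

definition multiadd :: "('x::plus list \<Rightarrow> 'z::plus) \<Rightarrow> bool" where
  "multiadd f \<longleftrightarrow> (\<forall>xs ys zs. sum_at xs ys zs \<longrightarrow> f zs = f xs + f ys)"

lemma multiaddD: "multiadd f \<Longrightarrow> sum_at xs ys zs \<Longrightarrow> f zs = f xs + f ys"
  by (auto simp: multiadd_def)

lemma multiadd_Cons: "multiadd f \<Longrightarrow> f ((x + y) # l) = f (x # l) + f (y # l)"
  by (auto simp: multiadd_def intro: sum_at.here)

lemma multiadd_shift: "multiadd f \<Longrightarrow> multiadd (\<lambda>ys. f (c # ys))"
  by (auto simp: multiadd_def intro: sum_at.there)

lemma multiadd_zero: "multiadd f \<Longrightarrow> f (0 # l) = 0"
  for f :: "'x::comm_monoid_add list \<Rightarrow> 'z::ab_group_add"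
  using multiadd_Cons[of f 0 0 l] by simp

lemma sum_at_length: "sum_at xs ys zs \<Longrightarrow> length xs = length zs \<and> length ys = length zs"
  by (induction rule: sum_at.induct) auto

lemma sum_at_split:
  assumes "sum_at xs ys zs"
  shows "sum_at (take k xs) (take k ys) (take k zs) \<and> drop k xs = drop k zs \<and> drop k ys = drop k zs
    \<or> take k xs = take k zs \<and> take k ys = take k zs \<and> sum_at (drop k xs) (drop k ys) (drop k zs)"
  using assms
proof (induction arbitrary: k rule: sum_at.induct)
  case (here x l y)
  then show ?case by (cases k) (auto intro: sum_at.here)
next
  case (there xs ys zs c)
  show ?case
  proof (cases k)
    case (Suc k')
    then show ?thesis using there.IH[of k'] by (auto intro: sum_at.there)
  qed (auto intro: sum_at.there there.hyps)
qed

lemma sum_at_Cons_cases: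
  assumes "sum_at xs ys (z # zs)"
  obtains x y where "xs = x # zs" "ys = y # zs" "z = x + y"
  | xs' ys' where "xs = z # xs'" "ys = z # ys'" "sum_at xs' ys' zs"
  using assms by (cases rule: sum_at.cases) auto

lemma multiadd_conv:
  assumes "\<And>us xs ys zs. sum_at xs ys zs \<Longrightarrow> h us zs = h us xs + h us ys"
    and "\<And>us xs ys zs. sum_at xs ys zs \<Longrightarrow> h zs us = h xs us + h ys us"
  shows "multiadd (conv h)"
  unfolding multiadd_def
proof (intro allI impI)
  fix xs ys zs :: "'a list" assume s: "sum_at xs ys zs"
  have "h (take k zs) (drop k zs) = h (take k xs) (drop k xs) + h (take k ys) (drop k ys)" for k
    using sum_at_split[OF s, of k]
  proof (elim disjE conjE)
    assume "sum_at (take k xs) (take k ys) (take k zs)" "drop k xs = drop k zs" "drop k ys = drop k zs"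
    then show ?thesis by (simp add: assms(2))
  next
    assume "take k xs = take k zs" "take k ys = take k zs" "sum_at (drop k xs) (drop k ys) (drop k zs)"
    then show ?thesis by (simp add: assms(1))
  qed
  then show "conv h zs = conv h xs + conv h ys"
    using sum_at_length[OF s] by (simp add: conv_def sum.distrib)
qed

lemma multiadd_lcomp:
  fixes f :: "'y::comm_monoid_add list \<Rightarrow> 'z::ab_group_add"
  assumes "multiadd f" "multiadd g"
  shows "multiadd (lcomp f g)"
proof -
  have "lcomp f g zs = lcomp f g xs + lcomp f g ys" if "sum_at xs ys zs" "multiadd f" for f xs ys zs
    using that
  proof (induction zs arbitrary: f xs ys rule: lcomp_induct)
    case Nil
    then show ?case by (auto elim: sum_at.cases)
  next
    case (Cons z zs)
    have g1: "lcomp (\<lambda>ys. f ((u + v) # ys)) g ws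
        = lcomp (\<lambda>ys. f (u # ys)) g ws + lcomp (\<lambda>ys. f (v # ys)) g ws" for u v ws
      by (simp add: multiadd_Cons[OF Cons.prems(2)] lcomp_add)
    from Cons.prems(1) show ?case
    proof (cases rule: sum_at_Cons_cases)
      case (1 x y)
      then show ?thesis
        unfolding 1 lcomp_Cons conv_add[symmetric]
        by (intro conv_cong) (simp add: multiadd_Cons[OF assms(2)] g1)
    next
      case (2 xs' ys')
      have "lcomp (\<lambda>ys. f (g (z # take k zs) # ys)) g (drop k zs)
          = lcomp (\<lambda>ys. f (g (z # take k xs') # ys)) g (drop k xs')
          + lcomp (\<lambda>ys. f (g (z # take k ys') # ys)) g (drop k ys')" for k
        using sum_at_split[OF 2(3), of k]
      proof (elim disjE conjE)
        assume a: "sum_at (take k xs') (take k ys') (take k zs)"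
          "drop k xs' = drop k zs" "drop k ys' = drop k zs"
        have "g (z # take k zs) = g (z # take k xs') + g (z # take k ys')"
          using a(1) by (intro multiaddD[OF assms(2)] sum_at.there)
        with a g1 show ?thesis by simp
      next
        assume a: "take k xs' = take k zs" "take k ys' = take k zs"
          "sum_at (drop k xs') (drop k ys') (drop k zs)"
        show ?thesis unfolding a(1,2)
          by (intro Cons.IH a(3) multiadd_shift Cons.prems(2)) auto
      qed
      then show ?thesis
        using sum_at_length[OF 2(3)] 2 by (simp add: lcomp_Cons conv_def sum.distrib)
    qed
  qed
  then show ?thesis using assms by (auto simp: multiadd_def)
qed

text \<open>Values of \<open>lcomp g h\<close> are sums sitting in the slots of \<open>f\<close>, so
  additivity of \<open>f\<close> is what allows them to be expanded. Afterwards both sides run over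
  the same two-level block structures.\<close>

lemma lcomp_assoc:
  fixes f :: "'y::comm_monoid_add list \<Rightarrow> 'z::ab_group_add"
  assumes "multiadd f"
  shows "lcomp f (lcomp g h) xs = lcomp (lcomp f g) h xs"
  using assms
proof (induction xs arbitrary: f rule: lcomp_induct)
  case (Cons x xs)
  let ?gh = "lcomp g h"
  \<comment> \<open>The value on the first block is a sum over cuts and then over inner blocks;
    \<open>pull\<close> and \<open>pull2\<close> move these two sums out of the first slot of
    \<open>f\<close>.\<close>
  have pull: "lcomp (\<lambda>ys. f (conv H ws # ys)) ?gh vs = conv (\<lambda>us us'. lcomp (\<lambda>ys. f (H us us' # ys)) ?gh vs) ws"
    for H ws vs
    by (rule additive_conv[of "\<lambda>z. lcomp (\<lambda>ys. f (z # ys)) ?gh vs"])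
      (simp_all add: multiadd_zero[OF Cons.prems] multiadd_Cons[OF Cons.prems] lcomp_add)
  have pull2: "lcomp (\<lambda>ys. f (lcomp H h ws # ys)) ?gh vs = lcomp (\<lambda>ps. lcomp (\<lambda>ys. f (H ps # ys)) ?gh vs) h ws"
    for H ws vs
    by (rule lcomp_additive[of "\<lambda>z. lcomp (\<lambda>ys. f (z # ys)) ?gh vs"])
      (simp_all add: multiadd_zero[OF Cons.prems] multiadd_Cons[OF Cons.prems] lcomp_add)
  have "lcomp f ?gh (x # xs) = conv (\<lambda>ws vs. conv (\<lambda>us us'.
      lcomp (\<lambda>ps. lcomp (\<lambda>ys. f (g (h (x # us) # ps) # ys)) ?gh vs) h us') ws) xs"
    unfolding lcomp_Cons[of f] by (intro conv_cong) (simp add: lcomp_Cons pull pull2)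
  also have "\<dots> = conv (\<lambda>us ws. conv (\<lambda>us' vs.
      lcomp (\<lambda>ps. lcomp (\<lambda>ys. f (g (h (x # us) # ps) # ys)) ?gh vs) h us') ws) xs"
    by (rule conv_assoc)
  also have "\<dots> = conv (\<lambda>us ws. conv (\<lambda>us' vs.
      lcomp (\<lambda>ps. lcomp (lcomp (\<lambda>ys. f (g (h (x # us) # ps) # ys)) g) h vs) h us') ws) xs"
    by (auto intro!: conv_cong lcomp_cong Cons.IH multiadd_shift Cons.prems)
  also have "\<dots> = lcomp (lcomp f g) h (x # xs)"
    unfolding lcomp_Cons[of "lcomp f g"] by (intro conv_cong) (simp add: lcomp_Cons lcomp_conv)
  finally show ?case .
qed simp

lemma conv_right_Nil: "conv (\<lambda>us vs. if vs = [] then F us else 0) xs = F xs"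
  by (induction xs arbitrary: F) (simp_all add: conv_Cons)

lemma conv_left_Nil: "conv (\<lambda>us vs. if us = [] then F vs else 0) xs = F xs"
  by (cases xs) (simp_all add: conv_Cons)

lemma lcomp_const: "lcomp (\<lambda>ys. if ys = [] then c else 0) g xs = (if xs = [] then c else 0)"
proof (cases xs)
  case (Cons x xs')
  have "lcomp (\<lambda>ys. if ys = [] then c else 0) g (x # xs') = conv (\<lambda>us vs. 0) xs'"
    unfolding lcomp_Cons by (intro conv_cong) simp
  with Cons show ?thesis by simp
qed simp

definition lid :: "'x::zero list \<Rightarrow> 'x" where
  "lid xs = (if length xs = 1 then hd xs else 0)"

lemma lid_simps [simp]: "lid [] = 0" "lid [x] = x" "lid (x # y # l) = 0"
  by (simp_all add: lid_def)

lemma lcomp_linear: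
  assumes "xs \<noteq> []"
  shows "lcomp (\<lambda>ys. if length ys = 1 then L (hd ys) else 0) g xs = L (g xs)"
proof (cases xs)
  case (Cons x xs')
  have "lcomp (\<lambda>ys. if length ys = 1 then L (hd ys) else 0) g (x # xs')
      = conv (\<lambda>us vs. if vs = [] then L (g (x # us)) else 0) xs'"
    unfolding lcomp_Cons
  proof (intro conv_cong)
    fix us vs
    have "(\<lambda>ys. if length (g (x # us) # ys) = 1 then L (hd (g (x # us) # ys)) else 0)
        = (\<lambda>ys. if ys = [] then L (g (x # us)) else 0)" by auto
    then show "lcomp (\<lambda>ys. if length (g (x # us) # ys) = 1 then L (hd (g (x # us) # ys)) else 0) g vs
        = (if vs = [] then L (g (x # us)) else 0)" by (simp only: lcomp_const)
  qed
  with Cons show ?thesis by (simp add: conv_right_Nil)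
qed (use assms in simp)

lemma lcomp_lid_left: "g [] = 0 \<Longrightarrow> lcomp lid g xs = g xs"
  using lcomp_linear[of xs "\<lambda>x. x" g] by (cases "xs = []") (simp_all add: lid_def[abs_def])

lemma lcomp_lid_right:
  fixes f :: "'y::comm_monoid_add list \<Rightarrow> 'z::ab_group_add"
  assumes "multiadd f"
  shows "lcomp f lid xs = f xs"
  using assms
proof (induction xs arbitrary: f rule: lcomp_induct)
  case (Cons x xs)
  have "lcomp f lid (x # xs) = conv (\<lambda>us vs. if us = [] then f (x # vs) else 0) xs"
    unfolding lcomp_Cons
  proof (intro conv_cong)
    fix us vs assume e: "us @ vs = xs"
    show "lcomp (\<lambda>ys. f (lid (x # us) # ys)) lid vs = (if us = [] then f (x # vs) else 0)"
    proof (cases us)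
      case Nil
      then show ?thesis using e Cons.IH[of vs "\<lambda>ys. f (x # ys)"] Cons.prems
        by (auto intro: multiadd_shift)
    qed (simp add: multiadd_zero[OF Cons.prems])
  qed
  then show ?case by (simp add: conv_left_Nil)
qed simp

lemma multiadd_lid: "multiadd (lid :: 'x::comm_monoid_add list \<Rightarrow> 'x)"
  unfolding multiadd_def
proof (intro allI impI)
  fix xs ys zs :: "'x list" assume "sum_at xs ys zs"
  then show "lid zs = lid xs + lid ys"
    by (induction rule: sum_at.induct) (auto simp: lid_def elim: sum_at.cases dest: sum_at_length)
qed

section \<open>Compositional inverses by recursion on the length\<close>

definition nonlin :: "('y list \<Rightarrow> 'z::zero) \<Rightarrow> 'y list \<Rightarrow> 'z" where
  "nonlin g ys = (if length ys = 1 then 0 else g ys)"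

lemma multiadd_nonlin: "multiadd g \<Longrightarrow> multiadd (nonlin g)" for g :: "_ \<Rightarrow> 'z::comm_monoid_add"
  by (auto simp: multiadd_def nonlin_def dest: sum_at_length)

text \<open>Only the decomposition into a single block evaluates \<open>g\<close> at the whole list;
  it contributes the linear term. The remainder sees \<open>g\<close> at strictly shorter nonempty
  lists, which is what recursions and inductions on the length exploit.\<close>

lemma lcomp_nonlin:
  assumes "xs \<noteq> []"
  shows "lcomp f g xs = f [g xs] + lcomp (nonlin f) g xs"
proof -
  have "f = (\<lambda>ys. (if length ys = 1 then f [hd ys] else 0) + nonlin f ys)"
    by (auto simp: nonlin_def fun_eq_iff length_Suc_conv)
  then have "lcomp f g xs = lcomp (\<lambda>ys. (if length ys = 1 then f [hd ys] else 0) + nonlin f ys) g xs"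
    by simp
  then show ?thesis
    by (simp only: lcomp_add lcomp_linear[OF assms, of "\<lambda>y. f [y]"])
qed

lemma lcomp_nonlin_cong:
  assumes "\<And>ys. ys \<noteq> [] \<Longrightarrow> length ys < length xs \<Longrightarrow> g ys = g' ys"
  shows "lcomp (nonlin f) g xs = lcomp (nonlin f) g' xs"
proof (cases xs)
  case (Cons x xs')
  have "lcomp (\<lambda>ys. nonlin f (g (x # us) # ys)) g vs = lcomp (\<lambda>ys. nonlin f (g' (x # us) # ys)) g' vs"
    if e: "us @ vs = xs'" for us vs
  proof (cases "vs = []")
    case False
    then show ?thesis using e Cons by (intro lcomp_cong) (auto intro!: assms simp: assms)
  qed (simp add: nonlin_def)
  then show ?thesis unfolding Cons lcomp_Cons by (intro conv_cong)
qed simp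

text \<open>With \<open>M\<close> inverse to the linear part of \<open>g\<close>, this solves
  \<open>g [h xs] + lcomp (nonlin g) h xs = lid xs\<close> for \<open>h xs\<close>. The length guard
  only secures termination; \<open>rinv_eq\<close> removes it.\<close>

function rinv :: "('x::ab_group_add list \<Rightarrow> 'x) \<Rightarrow> ('x \<Rightarrow> 'x) \<Rightarrow> 'x list \<Rightarrow> 'x" where
  "rinv g M xs =
     M (lid xs - lcomp (nonlin g) (\<lambda>ys. if length ys < length xs then rinv g M ys else 0) xs)"
  by auto
termination by (relation "measure (\<lambda>(g, M, xs). length xs)") auto

declare rinv.simps [simp del]

lemma rinv_eq: "rinv g M xs = M (lid xs - lcomp (nonlin g) (rinv g M) xs)"
  by (subst rinv.simps) (auto intro!: arg_cong[of _ _ M] lcomp_nonlin_cong)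

lemma lcomp_rinv:
  assumes "g [] = 0" "\<And>x. g [M x] = x"
  shows "lcomp g (rinv g M) xs = lid xs"
proof (cases "xs = []")
  case False
  then show ?thesis by (simp add: lcomp_nonlin[of xs g]) (simp add: rinv_eq[of g M xs] assms)
qed (simp add: assms)

lemma multiadd_rinv:
  assumes "multiadd g" "\<And>x y. M (x + y) = M x + M y"
  shows "multiadd (rinv g M)"
proof -
  have "rinv g M zs = rinv g M xs + rinv g M ys" if "sum_at xs ys zs" for xs ys zs
    using that
  proof (induction "length zs" arbitrary: xs ys zs rule: less_induct)
    case less
    \<comment> \<open>Truncation below the current length lets the induction hypothesis supply
      additivity of the inner function. All three lists have the same length, so one truncation
      serves them all.\<close>
    let ?r = "\<lambda>ys. if length ys < length zs then rinv g M ys else 0"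
    have "multiadd ?r"
      using less.hyps unfolding multiadd_def by (auto dest: sum_at_length)
    then have c: "multiadd (lcomp (nonlin g) ?r)"
      by (intro multiadd_lcomp multiadd_nonlin assms)
    have l: "length xs = length zs" "length ys = length zs"
      using sum_at_length[OF less.prems] by auto
    have "rinv g M zs = M (lid zs - lcomp (nonlin g) ?r zs)" by (subst rinv.simps) simp
    also have "\<dots> = M ((lid xs - lcomp (nonlin g) ?r xs) + (lid ys - lcomp (nonlin g) ?r ys))"
      by (simp add: multiaddD[OF c less.prems] multiaddD[OF multiadd_lid less.prems] algebra_simps)
    also have "\<dots> = M (lid xs - lcomp (nonlin g) ?r xs) + M (lid ys - lcomp (nonlin g) ?r ys)"
      by (rule assms)
    also have "\<dots> = rinv g M xs + rinv g M ys"
      by (simp only: rinv.simps[of g M xs] rinv.simps[of g M ys] l)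
    finally show ?case .
  qed
  then show ?thesis by (simp add: multiadd_def)
qed

text \<open>The recursion gives only a right inverse \<open>h\<close>. Its linear part is invertible
  too, so \<open>h\<close> has a right inverse \<open>h'\<close>, and g = g \<circ> (h \<circ> h') =
  (g \<circ> h) \<circ> h' = h' shows that \<open>h\<close> is two-sided.\<close>

lemma composition_inverse:
  fixes g :: "'x::ab_group_add list \<Rightarrow> 'x"
  assumes "multiadd g" "g [] = 0" "\<And>x. g [M x] = x" "\<And>x. M (g [x]) = x"
  obtains h where "multiadd h" "h [] = 0" "lcomp g h = lid" "lcomp h g = lid"
proof -
  have gadd: "g [x + y] = g [x] + g [y]" for x y by (rule multiadd_Cons[OF assms(1)])
  have M: "M (x + y) = M x + M y" for x y by (metis assms(3,4) gadd)
  have M0: "M 0 = 0" using M[of 0 0] by simp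
  define h where "h = rinv g M"
  have h0: "h [] = 0" by (simp add: h_def rinv_eq[of g M "[]"] nonlin_def assms M0)
  have h1: "h [x] = M x" for x
    unfolding h_def by (subst rinv_eq) (simp add: lcomp_Cons nonlin_def)
  have h: "multiadd h" unfolding h_def by (rule multiadd_rinv[OF assms(1) M])
  have gh: "lcomp g h = lid"
    by (rule ext) (simp add: h_def lcomp_rinv assms)
  define h' where "h' = rinv h (\<lambda>x. g [x])"
  have h'0: "h' [] = 0"
    using multiadd_zero[OF assms(1), of "[]"]
    by (simp add: h'_def rinv_eq[of h "\<lambda>x. g [x]" "[]"] nonlin_def h0)
  have hh': "lcomp h h' = lid"
    by (rule ext) (simp add: h'_def lcomp_rinv h0 h1 assms)
  have "g = lcomp g (lcomp h h')"
    by (rule ext) (simp only: hh' lcomp_lid_right[OF assms(1)])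
  also have "\<dots> = lcomp (lcomp g h) h'"
    by (rule ext) (rule lcomp_assoc[OF assms(1)])
  also have "\<dots> = h'" by (rule ext) (simp add: gh lcomp_lid_left h'0)
  finally have "lcomp h g = lid" using hh' by simp
  with h h0 gh that show ?thesis by blast
qed

text \<open>With left multiplications for \<open>\<sigma>\<close> and \<open>\<tau>\<close> this is
  left B-linearity in the first argument, the property that makes a series of the form I \<cdot> F,
  with F read off by putting 1 in the first place.\<close>

definition lhom :: "('x \<Rightarrow> 'x) \<Rightarrow> ('z \<Rightarrow> 'z) \<Rightarrow> ('x list \<Rightarrow> 'z) \<Rightarrow> bool" where
  "lhom \<sigma> \<tau> f \<longleftrightarrow> (\<forall>x xs. f (\<sigma> x # xs) = \<tau> (f (x # xs)))"

lemma lhomD: "lhom \<sigma> \<tau> f \<Longrightarrow> f (\<sigma> x # xs) = \<tau> (f (x # xs))"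
  by (simp add: lhom_def)

lemma lhom_lcomp:
  assumes "lhom \<sigma> \<tau> f" "lhom \<rho> \<sigma> g" "\<tau> 0 = 0" "\<And>x y. \<tau> (x + y) = \<tau> x + \<tau> y"
  shows "lhom \<rho> \<tau> (lcomp f g)"
  unfolding lhom_def
proof (intro allI)
  fix x xs
  have "\<tau> (lcomp f g (x # xs)) = conv (\<lambda>us vs. \<tau> (lcomp (\<lambda>ys. f (g (x # us) # ys)) g vs)) xs"
    unfolding lcomp_Cons by (rule additive_conv) (fact assms)+
  also have "\<dots> = lcomp f g (\<rho> x # xs)"
    unfolding lcomp_Cons
    by (intro conv_cong) (simp add: lcomp_additive[of \<tau>] assms lhomD[OF assms(1)] lhomD[OF assms(2)])
  finally show "lcomp f g (\<rho> x # xs) = \<tau> (lcomp f g (x # xs))" by simp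
qed

text \<open>In \<open>lcomp g h = lid\<close> the nonlinear part uses \<open>h\<close> on shorter
  lists only, so by induction it commutes with \<open>\<sigma>\<close>. Then so does the linear term
  \<open>g [h (x # xs)]\<close>, and injectivity of the linear part transfers this to
  \<open>h\<close>.\<close>

lemma lhom_inverse:
  fixes g :: "'x::ab_group_add list \<Rightarrow> 'x"
  assumes gh: "lcomp g h = lid" and g: "lhom \<sigma> \<sigma> g"
    and inj: "\<And>x y. g [x] = g [y] \<Longrightarrow> x = y"
    and \<sigma>: "\<sigma> 0 = 0" "\<And>x y. \<sigma> (x + y) = \<sigma> x + \<sigma> y"
  shows "lhom \<sigma> \<sigma> h"
proof -
  have "h (\<sigma> x # xs) = \<sigma> (h (x # xs))" for x xs
  proof (induction "length xs" arbitrary: xs rule: less_induct)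
    case less
    have "\<sigma> (lcomp (nonlin g) h (x # xs))
        = conv (\<lambda>us vs. \<sigma> (lcomp (\<lambda>ys. nonlin g (h (x # us) # ys)) h vs)) xs"
      unfolding lcomp_Cons by (rule additive_conv) (fact \<sigma>)+
    also have "\<dots> = lcomp (nonlin g) h (\<sigma> x # xs)"
      unfolding lcomp_Cons
    proof (intro conv_cong)
      fix us vs assume e: "us @ vs = xs"
      show "\<sigma> (lcomp (\<lambda>ys. nonlin g (h (x # us) # ys)) h vs)
          = lcomp (\<lambda>ys. nonlin g (h (\<sigma> x # us) # ys)) h vs"
      proof (cases "vs = []")
        case False
        have "\<sigma> (nonlin g (y # ys)) = nonlin g (\<sigma> y # ys)" for y ys
          by (simp add: nonlin_def lhomD[OF g] \<sigma>)
        with False e show ?thesis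
          by (auto simp: lcomp_additive[of \<sigma>, OF \<sigma>] less)
      qed (simp add: nonlin_def \<sigma>)
    qed
    finally have n: "lcomp (nonlin g) h (\<sigma> x # xs) = \<sigma> (lcomp (nonlin g) h (x # xs))" by simp
    have r: "g [h (y # xs)] + lcomp (nonlin g) h (y # xs) = lid (y # xs)" for y
      using lcomp_nonlin[of "y # xs" g h] by (simp add: gh)
    have "lid (\<sigma> x # xs) = \<sigma> (lid (x # xs))" by (simp add: lid_def \<sigma>)
    then have "g [h (\<sigma> x # xs)] + \<sigma> (lcomp (nonlin g) h (x # xs))
        = \<sigma> (g [h (x # xs)] + lcomp (nonlin g) h (x # xs))"
      using r[of "\<sigma> x"] by (simp add: n r)
    then have "g [h (\<sigma> x # xs)] = g [\<sigma> (h (x # xs))]"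
      by (simp add: \<sigma> lhomD[OF g])
    then show ?case by (rule inj)
  qed
  then show ?thesis by (simp add: lhom_def)
qed

lemma lcomp_right_inverse_unique:
  fixes g :: "'x::ab_group_add list \<Rightarrow> 'x"
  assumes "\<And>xs. lcomp g h xs = lid xs" "\<And>xs. lcomp g h' xs = lid xs" "h [] = h' []"
    and inj: "\<And>x y. g [x] = g [y] \<Longrightarrow> x = y"
  shows "h xs = h' xs"
proof (induction "length xs" arbitrary: xs rule: less_induct)
  case less
  show ?case
  proof (cases "xs = []")
    case False
    have "lcomp (nonlin g) h xs = lcomp (nonlin g) h' xs"
      using less by (intro lcomp_nonlin_cong)
    then have "g [h xs] = g [h' xs]"
      using lcomp_nonlin[OF False, of g h] lcomp_nonlin[OF False, of g h'] assms(1,2) by simp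
    then show ?thesis by (rule inj)
  qed (simp add: assms)
qed

section \<open>The ring of series\<close>

text \<open>Argument and coefficient types are kept apart, so that resolvents with coefficients in A
  and their B-valued expectations are series over the same argument lists.\<close>

typedef ('x, 'c) mser = "UNIV :: ('x list \<Rightarrow> 'c) set"
  morphisms coef MSer ..

setup_lifting type_definition_mser

lemma coef_MSer [simp]: "coef (MSer f) = f"
  by (rule MSer_inverse) simp

lemma mser_eqI: "(\<And>xs. coef F xs = coef G xs) \<Longrightarrow> F = G"
  by (auto simp: coef_inject[symmetric])

instantiation mser :: (type, ring_1) ring_1
begin

lift_definition zero_mser :: "('a, 'b) mser" is "\<lambda>_. 0" .
lift_definition one_mser :: "('a, 'b) mser" is "\<lambda>xs. if xs = [] then 1 else 0" .
lift_definition plus_mser :: "('a, 'b) mser \<Rightarrow> ('a, 'b) mser \<Rightarrow> ('a, 'b) mser"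
  is "\<lambda>F G xs. F xs + G xs" .
lift_definition minus_mser :: "('a, 'b) mser \<Rightarrow> ('a, 'b) mser \<Rightarrow> ('a, 'b) mser"
  is "\<lambda>F G xs. F xs - G xs" .
lift_definition uminus_mser :: "('a, 'b) mser \<Rightarrow> ('a, 'b) mser" is "\<lambda>F xs. - F xs" .
lift_definition times_mser :: "('a, 'b) mser \<Rightarrow> ('a, 'b) mser \<Rightarrow> ('a, 'b) mser"
  is "\<lambda>F G. conv (\<lambda>us vs. F us * G vs)" .

instance
proof
  fix F G H :: "('a, 'b) mser"
  have "conv (\<lambda>ws vs. conv (\<lambda>us us'. coef F us * coef G us') ws * coef H vs) xs
      = conv (\<lambda>ws vs. conv (\<lambda>us us'. coef F us * coef G us' * coef H vs) ws) xs" for xs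
    by (intro conv_cong additive_conv) (simp_all add: distrib_right)
  moreover have "conv (\<lambda>us ws. coef F us * conv (\<lambda>us' vs. coef G us' * coef H vs) ws) xs
      = conv (\<lambda>us ws. conv (\<lambda>us' vs. coef F us * coef G us' * coef H vs) ws) xs" for xs
    by (intro conv_cong trans[OF additive_conv[of "\<lambda>z. _ * z"]])
      (simp_all add: distrib_left mult.assoc)
  ultimately show "F * G * H = F * (G * H)"
    by (intro mser_eqI) (simp add: times_mser.rep_eq conv_assoc)
  have "conv (\<lambda>us vs. (if us = [] then 1 else 0) * coef F vs) xs
      = conv (\<lambda>us vs. if us = [] then coef F vs else 0) xs" for xs by (intro conv_cong) simp
  then show "1 * F = F"
    by (intro mser_eqI) (simp add: times_mser.rep_eq one_mser.rep_eq conv_left_Nil)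
  have "conv (\<lambda>us vs. coef F us * (if vs = [] then 1 else 0)) xs
      = conv (\<lambda>us vs. if vs = [] then coef F us else 0) xs" for xs by (intro conv_cong) simp
  then show "F * 1 = F"
    by (intro mser_eqI) (simp add: times_mser.rep_eq one_mser.rep_eq conv_right_Nil)
  show "F * (G + H) = F * G + F * H" "(F + G) * H = F * H + G * H"
    by (auto intro!: mser_eqI simp: times_mser.rep_eq plus_mser.rep_eq conv_add algebra_simps)
  show "(0 :: ('a, 'b) mser) \<noteq> 1"
    by transfer (metis zero_neq_one)
qed (transfer; auto simp: algebra_simps)+

end

lemmas coef_0 [simp] = zero_mser.rep_eq
  and coef_1 = one_mser.rep_eq
  and coef_add [simp] = plus_mser.rep_eq
  and coef_diff [simp] = minus_mser.rep_eq
  and coef_minus [simp] = uminus_mser.rep_eq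
  and coef_mult = times_mser.rep_eq

lemma coef_1_Nil [simp]: "coef 1 [] = 1"
  by (simp add: coef_1)

lemma coef_mult_Nil [simp]: "coef (F * G) [] = coef F [] * coef G []"
  by (simp add: coef_mult)

lemma coef_sum: "coef (sum F I) xs = (\<Sum>i\<in>I. coef (F i) xs)"
  by (induction I rule: infinite_finite_induct) auto

lift_definition cst :: "'c::zero \<Rightarrow> ('x, 'c) mser" is "\<lambda>c xs. if xs = [] then c else 0" .

lemma coef_cst: "coef (cst c) xs = (if xs = [] then c else 0)"
  by (simp add: cst.rep_eq)

lemma coef_mult_cst: "coef (F * cst c) xs = coef F xs * c"
proof -
  have "coef (F * cst c) xs = conv (\<lambda>us vs. if vs = [] then coef F us * c else 0) xs"
    unfolding coef_mult by (intro conv_cong) (simp add: coef_cst)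
  then show ?thesis by (simp add: conv_right_Nil)
qed

lemma cst_mult: "cst (c * d) = cst c * cst d"
  by (rule mser_eqI) (simp add: coef_mult_cst coef_cst)

section \<open>Geometric series and multiplicative inverses\<close>

lemma coef_mult_Cons_of_Nil_0:
  assumes "coef F [] = 0"
  shows "coef (F * G) (x # xs) = conv (\<lambda>us vs. coef F (x # us) * coef G vs) xs"
  by (simp add: coef_mult conv_Cons assms)

text \<open>Composing the product of a list with \<open>z\<close> sums the products of values of
  \<open>z\<close> over all cuts into nonempty blocks. For \<open>z\<close> without constant term
  this is the geometric series of \<open>z\<close>.\<close>

definition star :: "('x, 'c::ring_1) mser \<Rightarrow> ('x, 'c) mser" where
  "star z = MSer (lcomp prod_list (coef z))"

lemma star_unfold: "coef z [] = 0 \<Longrightarrow> star z = 1 + z * star z"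
proof (rule mser_eqI)
  fix xs assume z: "coef z [] = 0"
  show "coef (star z) xs = coef (1 + z * star z) xs"
  proof (cases xs)
    case (Cons x xs')
    have "lcomp prod_list (coef z) (x # xs')
        = conv (\<lambda>us vs. coef z (x # us) * lcomp prod_list (coef z) vs) xs'"
      unfolding lcomp_Cons
      by (intro conv_cong)
        (simp add: lcomp_additive[of "\<lambda>z. _ * z", symmetric] distrib_left)
    then show ?thesis
      by (simp add: Cons coef_mult_Cons_of_Nil_0 z star_def coef_1)
  qed (simp add: star_def z)
qed

lemma star_right_inverse: "coef z [] = 0 \<Longrightarrow> (1 - z) * star z = 1"
  using star_unfold[of z] by (simp add: algebra_simps)

text \<open>The right inverse \<open>star z\<close> is itself 1 - y with y free of constant term, so
  it has a right inverse \<open>star y\<close>, which must then coincide with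
  \<open>1 - z\<close>.\<close>

lemma star_left_inverse:
  assumes z: "coef z [] = 0"
  shows "star z * (1 - z) = 1"
proof -
  define y where "y = - (z * star z)"
  have s: "star z = 1 - y" using star_unfold[OF z] by (simp add: y_def)
  have "coef y [] = 0" by (simp add: y_def z)
  then have r: "star z * star y = 1" using s by (simp add: star_right_inverse)
  have "star y = (1 - z) * star z * star y" by (simp add: star_right_inverse[OF z])
  also have "\<dots> = 1 - z" by (simp add: mult.assoc r)
  finally show ?thesis using r by simp
qed

lemma star_unfold_right: "coef z [] = 0 \<Longrightarrow> star z = 1 + star z * z"
  using star_left_inverse[of z] by (simp add: algebra_simps)

lemma star_unique: "coef z [] = 0 \<Longrightarrow> (1 - z) * w = 1 \<Longrightarrow> w = star z"
  by (metis star_left_inverse mult.assoc mult_1 mult_1_right)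

lemma coef_power_eq_0:
  "coef z [] = 0 \<Longrightarrow> length xs < n \<Longrightarrow> coef (z ^ n * w) xs = 0"
proof (induction n arbitrary: xs)
  case (Suc n)
  show ?case
  proof (cases xs)
    case (Cons x xs')
    have "coef (z * (z ^ n * w)) (x # xs') = conv (\<lambda>us vs. 0) xs'"
      unfolding coef_mult_Cons_of_Nil_0[OF Suc.prems(1)]
      using Suc Cons by (intro conv_cong) auto
    then show ?thesis by (simp add: Cons mult.assoc)
  qed (simp add: Suc.prems mult.assoc)
qed simp

lemma star_geometric:
  assumes z: "coef z [] = 0"
  shows "star z = (\<Sum>i<n. z ^ i) + z ^ n * star z"
proof (induction n)
  case (Suc n)
  have "z ^ n * star z = z ^ n * (1 + z * star z)" using star_unfold[OF z] by simp
  also have "\<dots> = z ^ n + z ^ Suc n * star z"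
    by (simp only: distrib_left mult_1_right power_Suc2 mult.assoc)
  finally have "z ^ n * star z = z ^ n + z ^ Suc n * star z" .
  with Suc show ?case by (simp add: add.assoc)
qed simp

text \<open>Multiplying by the inverse of the constant term, on the right or on the left, gives a
  series 1 - z to which \<open>star\<close> applies; the resulting one-sided inverses agree.\<close>

lemma ex_inverse:
  assumes "bunit (coef F [])"
  obtains G where "F * G = 1" "G * F = 1"
proof -
  from assms obtain c where c: "coef F [] * c = 1" "c * coef F [] = 1"
    by (auto simp: bunit_def)
  define z where "z = 1 - F * cst c"
  have z: "coef z [] = 0" by (simp add: z_def coef_cst c)
  have r: "F * (cst c * star z) = 1"
    using star_right_inverse[OF z] by (simp add: z_def mult.assoc)
  define z' where "z' = 1 - cst c * F"
  have z': "coef z' [] = 0" by (simp add: z'_def coef_cst c)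
  have l: "star z' * cst c * F = 1"
    using star_left_inverse[OF z'] by (simp add: z'_def mult.assoc)
  have "star z' * cst c = star z' * cst c * (F * (cst c * star z))" by (simp add: r)
  also have "\<dots> = cst c * star z" by (simp only: l mult_1 mult.assoc[symmetric])
  finally show ?thesis using that[of "cst c * star z"] r l by simp
qed

section \<open>Substitution of series\<close>

definition cmp :: "('y, 'c::ring_1) mser \<Rightarrow> ('x, 'y) mser \<Rightarrow> ('x, 'c) mser" where
  "cmp F G = MSer (lcomp (coef F) (coef G))"

lemma coef_cmp: "coef (cmp F G) = lcomp (coef F) (coef G)"
  by (simp add: cmp_def)

lemma coef_cmp_Nil [simp]: "coef (cmp F G) [] = coef F []"
  by (simp add: coef_cmp)

lemma cmp_mult: "cmp (F * F') G = cmp F G * cmp F' G"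
proof (rule mser_eqI)
  fix xs
  have "lcomp (\<lambda>ps. lcomp (\<lambda>qs. coef F ps * coef F' qs) (coef G) vs) (coef G) us
      = lcomp (coef F) (coef G) us * lcomp (coef F') (coef G) vs" for us vs
    by (simp add: lcomp_additive[of "\<lambda>z. _ * z", symmetric] distrib_left
        lcomp_additive[of "\<lambda>z. z * _", symmetric] distrib_right)
  then show "coef (cmp (F * F') G) xs = coef (cmp F G * cmp F' G) xs"
    by (simp add: coef_cmp coef_mult lcomp_conv)
qed

definition TT :: "('b, 'b::ring_1) mser" where
  "TT = MSer lid"

lemma coef_TT: "coef TT = lid"
  by (simp add: TT_def)

lemma coef_TT_Nil [simp]: "coef TT [] = 0"
  by (simp add: coef_TT)

lemma coef_TT_mult [simp]: "coef (TT * F) (x # xs) = x * coef F xs"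
proof -
  have "coef (TT * F) (x # xs) = conv (\<lambda>us vs. if us = [] then x * coef F vs else 0) xs"
    unfolding coef_mult_Cons_of_Nil_0[OF coef_TT_Nil]
    by (intro conv_cong) (auto simp: coef_TT lid_def)
  then show ?thesis by (simp add: conv_left_Nil)
qed

lemma TT_mult_cancel: "TT * F = TT * G \<Longrightarrow> F = G"
  by (rule mser_eqI) (metis coef_TT_mult mult_1)

lemma cmp_TT_left: "coef G [] = 0 \<Longrightarrow> cmp TT G = G"
  by (rule mser_eqI) (simp add: coef_cmp coef_TT lcomp_lid_left)

lemma cmp_assoc: "multiadd (coef F) \<Longrightarrow> cmp F (cmp G H) = cmp (cmp F G) H"
  by (rule mser_eqI) (simp add: coef_cmp lcomp_assoc)

lemma one_add_unit:
  assumes "coef \<tau> [] = 0"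
  shows "(1 + \<tau>) * star (- \<tau>) = 1" "star (- \<tau>) * (1 + \<tau>) = 1"
  using star_right_inverse[of "- \<tau>"] star_left_inverse[of "- \<tau>"] assms by simp_all

text \<open>The coefficient of \<open>\<phi>\<close> at a list is determined by those at shorter lists,
  since \<open>\<chi>\<close> has no constant term.\<close>
lemma fixpoint_unique:
  assumes \<chi>: "coef \<chi> [] = 0"
    and "\<phi> = cmp K ((1 + \<phi>) * \<chi>)" "\<psi> = cmp K ((1 + \<psi>) * \<chi>)"
  shows "\<phi> = \<psi>"
proof (rule mser_eqI)
  fix xs
  show "coef \<phi> xs = coef \<psi> xs"
  proof (induction "length xs" arbitrary: xs rule: less_induct)
    case less
    have "coef ((1 + \<phi>) * \<chi>) ys = coef ((1 + \<psi>) * \<chi>) ys" if "length ys \<le> length xs" for ys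
      unfolding coef_mult
    proof (intro conv_cong)
      fix us vs assume "us @ vs = ys"
      then show "coef (1 + \<phi>) us * coef \<chi> vs = coef (1 + \<psi>) us * coef \<chi> vs"
        using that less[of us] by (cases vs) (auto simp: \<chi>)
    qed
    then have "coef (cmp K ((1 + \<phi>) * \<chi>)) xs = coef (cmp K ((1 + \<psi>) * \<chi>)) xs"
      unfolding coef_cmp by (intro lcomp_cong) auto
    with assms(2,3) show ?case by simp
  qed
qed

section \<open>Moments and cumulants\<close>

lemma finite_tsize: "finite {\<tau>. tsize \<tau> = n}"
proof -
  have "finite {\<tau>. tsize \<tau> \<le> n}"
  proof (induction n)
    case 0
    have "{\<tau>. tsize \<tau> \<le> 0} = {Leaf}"
      by (auto elim: tsize.elims)
    then show ?case by simp
  next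
    case (Suc n)
    have "{\<tau>. tsize \<tau> \<le> Suc n}
        \<subseteq> insert Leaf ((\<lambda>(l, r). Node l r) ` ({\<tau>. tsize \<tau> \<le> n} \<times> {\<tau>. tsize \<tau> \<le> n}))"
    proof
      fix \<tau> assume "\<tau> \<in> {\<tau>. tsize \<tau> \<le> Suc n}"
      then show "\<tau> \<in> insert Leaf ((\<lambda>(l, r). Node l r) ` ({\<tau>. tsize \<tau> \<le> n} \<times> {\<tau>. tsize \<tau> \<le> n}))"
        by (cases \<tau>) auto
    qed
    then show ?case using Suc by (meson finite_SigmaI finite_imageI finite_insert finite_subset)
  qed
  then show ?thesis by (rule rev_finite_subset) auto
qed

lemma tsize_0: "{\<tau>. tsize \<tau> = 0} = {Leaf}"
proof -
  have "tsize \<tau> = 0 \<longleftrightarrow> \<tau> = Leaf" for \<tau> by (cases \<tau>) auto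
  then show ?thesis by auto
qed

lemma sum_trees_Suc:
  "(\<Sum>\<tau> | tsize \<tau> = Suc n. F \<tau>)
    = (\<Sum>k\<le>n. \<Sum>l | tsize l = k. \<Sum>r | tsize r = n - k. F (Node l r))"
proof -
  have "(\<Sum>k\<le>n. \<Sum>l | tsize l = k. \<Sum>r | tsize r = n - k. F (Node l r))
      = (\<Sum>k\<le>n. \<Sum>(l, r)\<in>{l. tsize l = k} \<times> {r. tsize r = n - k}. F (Node l r))"
    by (simp add: sum.cartesian_product)
  also have "\<dots> = (\<Sum>(k, l, r)\<in>Sigma {..n} (\<lambda>k. {l. tsize l = k} \<times> {r. tsize r = n - k}). F (Node l r))"
    by (subst sum.Sigma) (auto simp: finite_tsize)
  also have "\<dots> = (\<Sum>\<tau> | tsize \<tau> = Suc n. F \<tau>)"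
    by (rule sum.reindex_bij_witness[where j = "\<lambda>(k, l, r). Node l r"
          and i = "\<lambda>\<tau>. case \<tau> of Node l r \<Rightarrow> (tsize l, l, r)"])
      (auto split: ptree.splits)
  finally show ?thesis by simp
qed

lemma length_kargs: "length (kargs \<kappa> lact \<tau> as) = length (spine \<tau>)"
  by (induction \<tau> arbitrary: as) auto

lemma kt_conv_kargs: "\<tau> \<noteq> Leaf \<Longrightarrow> kt \<kappa> lact \<tau> as = \<kappa> (length (spine \<tau>)) (kargs \<kappa> lact \<tau> as)"
  by (cases \<tau>) auto

lemma length_spine: "length (spine \<tau>) \<le> tsize \<tau>"
  by (induction \<tau>) auto

text \<open>The right comb is the only tree of size n with spine length n, and its term is
  \<kappa>_n(a_1,...,a_n) itself. All other trees involve only \<kappa>_j with j < n, so the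
  moment-cumulant relation is triangular and determines the cumulants.\<close>

fun comb :: "nat \<Rightarrow> ptree" where
  "comb 0 = Leaf"
| "comb (Suc n) = Node Leaf (comb n)"

lemma tsize_comb [simp]: "tsize (comb n) = n"
  by (induction n) auto

lemma length_spine_comb [simp]: "length (spine (comb n)) = n"
  by (induction n) auto

lemma length_spine_less: "\<tau> \<noteq> comb (tsize \<tau>) \<Longrightarrow> length (spine \<tau>) < tsize \<tau>"
proof (induction \<tau>)
  case (Node l r)
  show ?case
  proof (cases "l = Leaf")
    case False
    then have "tsize l > 0" by (cases l) auto
    then show ?thesis using length_spine[of r] by simp
  qed (use Node in auto)
qed simp

text \<open>\<open>kargs\<close> evaluates \<open>kt\<close> only at left subtrees, which are
  strictly smaller than \<open>\<tau>\<close>; hence agreement below \<open>n\<close> suffices for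
  \<open>kargs\<close> at size \<open>n\<close>, whereas \<open>kt\<close> needs a smaller
  tree.\<close>

lemma kt_kargs_cong:
  assumes "\<And>j. j < n \<Longrightarrow> \<kappa> j = \<kappa>' j" "tsize \<tau> \<le> n"
  shows "kargs \<kappa> lact \<tau> as = kargs \<kappa>' lact \<tau> as \<and>
    (tsize \<tau> < n \<longrightarrow> kt \<kappa> lact \<tau> as = kt \<kappa>' lact \<tau> as)"
  using assms(2)
proof (induction \<tau> arbitrary: as)
  case (Node l r)
  have l: "kt \<kappa> lact l as = kt \<kappa>' lact l as" and r: "kargs \<kappa> lact r as = kargs \<kappa>' lact r as" for as
    using Node.IH(1)[of as] Node.IH(2)[of as] Node.prems by auto
  show ?case using length_spine[of r] by (auto simp: l r assms(1))
qed simp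

section \<open>Moments and cumulants of a B-valued probability space\<close>

locale bprob =
  fixes sB :: "'k::field_char_0 \<Rightarrow> 'b::ring_1 \<Rightarrow> 'b"
    and sA :: "'k \<Rightarrow> 'a::ring_1 \<Rightarrow> 'a"
    and lact :: "'b \<Rightarrow> 'a \<Rightarrow> 'a"
    and ract :: "'a \<Rightarrow> 'b \<Rightarrow> 'a"
    and E :: "'a \<Rightarrow> 'b"
  assumes bprob_space: "bprob_space sB sA lact ract E"
begin

text \<open>By the mixed associativity laws both actions are multiplications by
  \<open>emb x\<close>, so bimodule computations become ring computations in A.\<close>

definition emb :: "'b \<Rightarrow> 'a" where
  "emb x = lact x 1"

lemma lact_emb: "lact x u = emb x * u"
  using bprob_space unfolding bprob_space_def emb_def by (metis mult_1)

lemma ract_emb: "ract u x = u * emb x"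
  using bprob_space unfolding bprob_space_def emb_def by (metis mult_1_right)

lemma emb_add [simp]: "emb (x + y) = emb x + emb y"
  using bprob_space unfolding bprob_space_def emb_def by metis

lemma emb_mult [simp]: "emb (x * y) = emb x * emb y"
proof -
  have "lact (x * y) 1 = lact x (lact y 1)"
    using bprob_space unfolding bprob_space_def by metis
  then show ?thesis by (simp add: emb_def[symmetric] lact_emb)
qed

lemma emb_1 [simp]: "emb 1 = 1"
  using bprob_space unfolding bprob_space_def emb_def by metis

lemma emb_0 [simp]: "emb 0 = 0"
  using emb_add[of 0 0] by simp

lemma emb_sum: "emb (sum f I) = (\<Sum>i\<in>I. emb (f i))"
  by (induction I rule: infinite_finite_induct) auto

lemma E_add [simp]: "E (u + v) = E u + E v"
  using bprob_space unfolding bprob_space_def by metis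

lemma E_1 [simp]: "E 1 = 1"
  using bprob_space unfolding bprob_space_def by metis

lemma E_0 [simp]: "E 0 = 0"
  using E_add[of 0 0] by simp

lemma E_bimodule: "E (emb x * u * emb y) = x * E u * y"
proof -
  have "E (ract (lact x u) y) = x * E u * y"
    using bprob_space unfolding bprob_space_def by metis
  then show ?thesis by (simp only: lact_emb ract_emb)
qed

lemma E_left [simp]: "E (emb x * u) = x * E u"
  using E_bimodule[of x u 1] by simp

lemma E_right [simp]: "E (u * emb x) = E u * x"
  using E_bimodule[of 1 u x] by simp

definition mom :: "'a list \<Rightarrow> 'b" where
  "mom as = E (prod_list as)"

text \<open>With \<open>mom\<close> for the moments, the series \<open>mom \<cdot> I\<close>; the moment-cumulant relation
  reads \<open>mom = 1 + \<kappa> \<circ> momI\<close>.\<close>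
definition momI :: "'a list \<Rightarrow> 'a" where
  "momI = conv (\<lambda>us vs. emb (mom us) * lid vs)"

lemma mom_Nil [simp]: "mom [] = 1"
  by (simp add: mom_def)

lemma prod_list_sum_at: "sum_at xs ys zs \<Longrightarrow> prod_list zs = prod_list xs + prod_list ys"
  for xs :: "'a list"
  by (induction rule: sum_at.induct) (auto simp: algebra_simps)

lemma multiadd_mom: "multiadd mom"
  by (simp add: multiadd_def mom_def prod_list_sum_at)

lemma mom_lhom: "lhom (\<lambda>a. emb y * a) (\<lambda>z. y * z) mom"
  by (simp add: lhom_def mom_def mult.assoc)

lemma multiadd_momI: "multiadd momI"
  unfolding momI_def
  by (rule multiadd_conv)
    (simp_all add: multiaddD[OF multiadd_mom] multiaddD[OF multiadd_lid] algebra_simps)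

lemma momI_Nil [simp]: "momI [] = 0"
  by (simp add: momI_def)

lemma momI_single [simp]: "momI [a] = a"
  by (simp add: momI_def conv_Cons)

lemma momI_snoc: "momI (us @ [a]) = emb (mom us) * a"
proof -
  have "conv (\<lambda>us vs. F us * lid vs) (us @ [a]) = F us * a" for F :: "'a list \<Rightarrow> 'a"
    by (induction us arbitrary: F) (auto simp: conv_Cons lid_def)
  then show ?thesis by (simp add: momI_def)
qed

lemma momI_lhom: "lhom (\<lambda>a. emb y * a) (\<lambda>a. emb y * a) momI"
  unfolding lhom_def
proof (intro allI)
  fix x xs
  have "emb y * conv (\<lambda>us vs. emb (mom (x # us)) * lid vs) xs
      = conv (\<lambda>us vs. emb y * (emb (mom (x # us)) * lid vs)) xs"
    by (rule additive_conv) (simp_all add: distrib_left)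
  then show "momI (emb y * x # xs) = emb y * momI (x # xs)"
    by (simp add: momI_def conv_Cons lhomD[OF mom_lhom] distrib_left mult.assoc lid_def)
qed

text \<open>Since \<open>momI [a] = a\<close>, the series \<open>momI\<close> has a compositional
  inverse \<open>h\<close>, and composing \<open>mom\<close> without its constant term with
  \<open>h\<close> solves the relation. Left linearity passes through the inverse and the
  composition.\<close>

lemma ex_cumulant:
  obtains \<kappa> :: "'a list \<Rightarrow> 'b"
  where "multiadd \<kappa>" "\<kappa> [] = 0" "\<And>as. as \<noteq> [] \<Longrightarrow> lcomp \<kappa> momI as = mom as"
    "\<And>y. lhom (\<lambda>a. emb y * a) (\<lambda>z. y * z) \<kappa>"
proof -
  obtain h where h: "multiadd h" "h [] = 0" "lcomp momI h = lid" "lcomp h momI = lid"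
    using composition_inverse[of momI "\<lambda>x. x"] multiadd_momI by auto
  define m0 where "m0 as = (if as = [] then 0 else mom as)" for as
  have m0: "multiadd m0"
    unfolding multiadd_def
  proof (intro allI impI)
    fix xs ys zs :: "'a list" assume s: "sum_at xs ys zs"
    then have "zs \<noteq> []" "xs \<noteq> []" "ys \<noteq> []" by (auto elim: sum_at.cases)
    then show "m0 zs = m0 xs + m0 ys" by (simp add: m0_def multiaddD[OF multiadd_mom s])
  qed
  have m0h: "lhom (\<lambda>a. emb y * a) (\<lambda>z. y * z) m0" for y
    by (simp add: lhom_def m0_def lhomD[OF mom_lhom])
  have hh: "lhom (\<lambda>a. emb y * a) (\<lambda>a. emb y * a) h" for y
    by (rule lhom_inverse[OF h(3) momI_lhom]) (simp_all add: distrib_left)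
  show ?thesis
  proof (rule that[of "lcomp m0 h"])
    show "multiadd (lcomp m0 h)" by (intro multiadd_lcomp m0 h)
    show "lcomp m0 h [] = 0" by (simp add: m0_def)
    show "lcomp (lcomp m0 h) momI as = mom as" if "as \<noteq> []" for as
      using that by (simp add: lcomp_assoc[OF m0, symmetric] h lcomp_lid_right[OF m0]) (simp add: m0_def)
    show "lhom (\<lambda>a. emb y * a) (\<lambda>z. y * z) (lcomp m0 h)" for y
      by (rule lhom_lcomp[OF m0h hh]) (simp_all add: distrib_left)
  qed
qed

text \<open>The right spine of a tree cuts the list into blocks, each consisting of the entries read
  by one subtree and one closing entry. Summing over the subtree turns its contribution into a
  moment, so the block yields \<open>momI\<close>. Taking \<open>\<kappa>\<close> for
  \<open>f\<close> gives the moment-cumulant relation; an arbitrary \<open>f\<close> is needed to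
  absorb the first block in the induction.\<close>

lemma tree_sum_lcomp:
  fixes \<kappa> :: "'a list \<Rightarrow> 'b"
  defines "\<kappa>' \<equiv> \<lambda>n as. if length as = n then \<kappa> as else 0"
  assumes \<kappa>: "multiadd \<kappa>" "\<And>as. as \<noteq> [] \<Longrightarrow> lcomp \<kappa> momI as = mom as"
    and f: "multiadd (f :: 'a list \<Rightarrow> 'b)"
  shows "(\<Sum>\<tau> | tsize \<tau> = length as. f (kargs \<kappa>' lact \<tau> as)) = lcomp f momI as"
  using f
proof (induction as arbitrary: f rule: lcomp_induct)
  case Nil
  then show ?case by (simp add: tsize_0)
next
  case (Cons x xs)
  let ?as = "x # xs"
  \<comment> \<open>The induction hypothesis with \<open>\<kappa>\<close> for \<open>f\<close>, on
    lists shorter than the given one.\<close>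
  have mom: "(\<Sum>\<tau> | tsize \<tau> = length us. kt \<kappa>' lact \<tau> us) = mom us" if "length us \<le> length xs" for us
  proof (cases "us = []")
    case False
    then have "(\<Sum>\<tau> | tsize \<tau> = length us. kt \<kappa>' lact \<tau> us)
        = (\<Sum>\<tau> | tsize \<tau> = length us. \<kappa> (kargs \<kappa>' lact \<tau> us))"
      by (intro sum.cong refl) (subst kt_conv_kargs, auto simp: \<kappa>'_def length_kargs)
    also have "\<dots> = mom us" using Cons.IH[OF that \<kappa>(1)] \<kappa>(2)[OF False] by simp
    finally show ?thesis .
  qed (simp add: tsize_0)
  have "(\<Sum>l | tsize l = k. \<Sum>r | tsize r = length xs - k. f (kargs \<kappa>' lact (Node l r) ?as))
      = lcomp (\<lambda>ys. f (momI (x # take k xs) # ys)) momI (drop k xs)" if k: "k \<le> length xs" for k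
  proof -
    define \<Phi> where "\<Phi> z = lcomp (\<lambda>ys. f (z # ys)) momI (drop k xs)" for z
    have \<Phi>: "\<Phi> (u + v) = \<Phi> u + \<Phi> v" "\<Phi> 0 = 0" for u v
      by (simp_all add: \<Phi>_def multiadd_Cons[OF Cons.prems] multiadd_zero[OF Cons.prems] lcomp_add)
    have \<Phi>_sum: "\<Phi> (sum g I) = (\<Sum>i\<in>I. \<Phi> (g i))" for g and I :: "ptree set"
      by (induction I rule: infinite_finite_induct) (auto simp: \<Phi>)
    \<comment> \<open>A left subtree of size \<open>k\<close> reads the first \<open>k\<close>
      entries and the next one closes the block, so the block \<open>x # take k xs\<close> of length
      \<open>Suc k\<close> is \<open>?us\<close> followed by \<open>?as ! k\<close>.\<close>
    let ?us = "take k ?as"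
    have "(\<Sum>r | tsize r = length xs - k. f (kargs \<kappa>' lact (Node l r) ?as))
        = \<Phi> (emb (kt \<kappa>' lact l ?us) * ?as ! k)" if "tsize l = k" for l
      using that Cons.IH[of "drop k xs" "\<lambda>ys. f (emb (kt \<kappa>' lact l ?us) * ?as ! k # ys)"]
        multiadd_shift[OF Cons.prems] by (simp add: \<Phi>_def lact_emb[of "kt \<kappa>' lact l ?us"])
    then have "(\<Sum>l | tsize l = k. \<Sum>r | tsize r = length xs - k. f (kargs \<kappa>' lact (Node l r) ?as))
        = (\<Sum>l | tsize l = k. \<Phi> (emb (kt \<kappa>' lact l ?us) * ?as ! k))" by simp
    also have "\<dots> = \<Phi> (emb (\<Sum>l | tsize l = k. kt \<kappa>' lact l ?us) * ?as ! k)"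
      by (simp only: \<Phi>_sum[symmetric] emb_sum sum_distrib_right)
    also have "(\<Sum>l | tsize l = k. kt \<kappa>' lact l ?us) = mom ?us"
      using mom[of ?us] k by (simp add: min_def split: if_splits)
    also have "emb (mom ?us) * ?as ! k = momI (x # take k xs)"
      using momI_snoc[of ?us "?as ! k"] take_Suc_conv_app_nth[of k ?as] k by simp
    finally show ?thesis by (simp add: \<Phi>_def)
  qed
  then show ?case by (simp add: sum_trees_Suc lcomp_Cons conv_def)
qed

definition moment_cumulant :: "(nat \<Rightarrow> 'a list \<Rightarrow> 'b) \<Rightarrow> bool" where
  "moment_cumulant \<kappa> \<longleftrightarrow> (\<forall>as. \<kappa> 0 as = 0) \<and>
      (\<forall>n as. length as \<noteq> n \<longrightarrow> \<kappa> n as = 0) \<and>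
      (\<forall>n as. n \<ge> 1 \<longrightarrow> length as = n \<longrightarrow>
          E (prod_list as) = (\<Sum>\<tau>\<in>{\<tau>. tsize \<tau> = n}. kt \<kappa> lact \<tau> as))"

lemma kargs_comb: "kargs \<kappa> lact (comb (length as)) as = as"
  by (induction as) (auto simp: lact_emb)

lemma moment_cumulant_unique:
  assumes "moment_cumulant \<kappa>" "moment_cumulant \<kappa>'"
  shows "\<kappa> = \<kappa>'"
proof -
  have "\<kappa> n = \<kappa>' n" for n
  proof (induction n rule: less_induct)
    case (less n)
    show ?case
    proof
      fix as
      show "\<kappa> n as = \<kappa>' n as"
      proof (cases "length as = n \<and> n \<ge> 1")
        case True
        then have n: "length as = n" "n \<ge> 1" by auto
        let ?T = "{\<tau>. tsize \<tau> = n} - {comb n}"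
        have split: "(\<Sum>\<tau> | tsize \<tau> = n. kt \<mu> lact \<tau> as) = \<mu> n as + (\<Sum>\<tau>\<in>?T. kt \<mu> lact \<tau> as)"
          for \<mu> :: "nat \<Rightarrow> 'a list \<Rightarrow> 'b"
        proof -
          have "comb n \<noteq> Leaf" using n by (cases n) auto
          then have "kt \<mu> lact (comb n) as = \<mu> n as"
            using kargs_comb[of \<mu> as] n by (simp add: kt_conv_kargs)
          then show ?thesis
            by (subst sum.remove[of _ "comb n"]) (auto simp: finite_tsize)
        qed
        have "kt \<kappa> lact \<tau> as = kt \<kappa>' lact \<tau> as" if "\<tau> \<in> ?T" for \<tau>
        proof -
          have \<tau>: "tsize \<tau> = n" "\<tau> \<noteq> comb n" using that by auto
          then have "length (spine \<tau>) < n" using length_spine_less[of \<tau>] by simp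
          moreover have "\<tau> \<noteq> Leaf" using \<tau> n by auto
          ultimately show ?thesis
            using kt_kargs_cong[of n \<kappa> \<kappa>' \<tau> lact as] \<tau> less by (simp add: kt_conv_kargs)
        qed
        then have "(\<Sum>\<tau>\<in>?T. kt \<kappa> lact \<tau> as) = (\<Sum>\<tau>\<in>?T. kt \<kappa>' lact \<tau> as)" by simp
        moreover have "(\<Sum>\<tau> | tsize \<tau> = n. kt \<kappa> lact \<tau> as) = (\<Sum>\<tau> | tsize \<tau> = n. kt \<kappa>' lact \<tau> as)"
          using assms n by (simp add: moment_cumulant_def)
        ultimately show ?thesis by (simp add: split)
      next
        case False
        then show ?thesis using assms by (cases n) (auto simp: moment_cumulant_def)
      qed
    qed
  qed
  then show ?thesis by (rule ext)
qed

definition kap :: "'a list \<Rightarrow> 'b" where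
  "kap as = cumulants lact E (length as) as"

text \<open>This resolves the definite description in \<open>cumulants\<close>: the solution from
  \<open>ex_cumulant\<close> satisfies the tree relation by \<open>tree_sum_lcomp\<close>, and
  triangularity makes it the only one.\<close>

lemma kap:
  shows multiadd_kap: "multiadd kap"
    and lcomp_kap_momI: "as \<noteq> [] \<Longrightarrow> lcomp kap momI as = mom as"
    and kap_lhom: "lhom (\<lambda>a. emb y * a) (\<lambda>z. y * z) kap"
    and kap_Nil: "kap [] = 0"
    and cumulants_wrong_length: "length as \<noteq> n \<Longrightarrow> cumulants lact E n as = 0"
proof -
  obtain \<kappa> :: "'a list \<Rightarrow> 'b" where \<kappa>: "multiadd \<kappa>" "\<kappa> [] = 0"
    "\<And>as. as \<noteq> [] \<Longrightarrow> lcomp \<kappa> momI as = mom as"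
    "\<And>y. lhom (\<lambda>a. emb y * a) (\<lambda>z. y * z) \<kappa>"
    by (rule ex_cumulant) blast
  let ?\<kappa> = "\<lambda>n as. if length as = n then \<kappa> as else 0"
  have mc: "moment_cumulant ?\<kappa>"
    unfolding moment_cumulant_def
  proof (intro conjI allI impI)
    fix n and as :: "'a list" assume n: "n \<ge> 1" "length as = n"
    have "E (prod_list as) = lcomp \<kappa> momI as"
      using \<kappa>(3)[of as] n by (cases as) (auto simp: mom_def)
    also have "\<dots> = (\<Sum>\<tau> | tsize \<tau> = n. \<kappa> (kargs ?\<kappa> lact \<tau> as))"
      using tree_sum_lcomp[OF \<kappa>(1,3) \<kappa>(1), of as] n by simp
    also have "\<dots> = (\<Sum>\<tau> | tsize \<tau> = n. kt ?\<kappa> lact \<tau> as)"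
      using n by (intro sum.cong refl) (subst kt_conv_kargs, auto simp: length_kargs)
    finally show "E (prod_list as) = (\<Sum>\<tau> | tsize \<tau> = n. kt ?\<kappa> lact \<tau> as)" .
  qed (use \<kappa> in auto)
  have c: "cumulants lact E = ?\<kappa>"
    unfolding cumulants_def moment_cumulant_def[symmetric]
    by (rule the_equality[of moment_cumulant, OF mc]) (rule moment_cumulant_unique[OF _ mc])
  then have k: "kap = \<kappa>" by (auto simp: kap_def)
  show "multiadd kap" "as \<noteq> [] \<Longrightarrow> lcomp kap momI as = mom as"
    "lhom (\<lambda>a. emb y * a) (\<lambda>z. y * z) kap" "kap [] = 0"
    "length as \<noteq> n \<Longrightarrow> cumulants lact E n as = 0"
    using \<kappa> by (simp_all add: k c)
qed

end

section \<open>Freeness and resolvents\<close>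

fun alts :: "bool \<Rightarrow> nat \<Rightarrow> bool list" where
  "alts j 0 = []"
| "alts j (Suc n) = j # alts (\<not> j) n"

lemma distinct_adj_alts: "distinct_adj (alts j n)" "distinct_adj ((\<not> j) # alts j n)"
proof -
  have "distinct_adj (j # alts (\<not> j) n)" for j
  proof (induction n arbitrary: j)
    case (Suc n)
    then show ?case using Suc[of "\<not> j"] by simp
  qed simp
  from this[of "\<not> j"] show "distinct_adj ((\<not> j) # alts j n)" by simp
  then show "distinct_adj (alts j n)" by (rule distinct_adj_ConsD)
qed

lemma alternating_power:
  fixes X Y :: "'r::monoid_mult"
  shows "prod_list (map (\<lambda>j. if j then X else Y) (alts True (2 * i))) = (X * Y) ^ i"
    and "prod_list (map (\<lambda>j. if j then X else Y) (alts True (Suc (2 * i)))) = (X * Y) ^ i * X"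
proof -
  show "prod_list (map (\<lambda>j. if j then X else Y) (alts True (2 * i))) = (X * Y) ^ i"
    by (induction i) (simp_all add: mult.assoc)
  show "prod_list (map (\<lambda>j. if j then X else Y) (alts True (Suc (2 * i)))) = (X * Y) ^ i * X"
    by (induction i) (simp_all add: mult.assoc)
qed

section \<open>Series with coefficients in A and their expectations\<close>

context bprob
begin

text \<open>Applied coefficientwise, \<open>Is\<close> and \<open>Es\<close> make the A-valued
  series a probability space over the ring of B-valued series; \<open>Es_left\<close> and
  \<open>Es_right\<close> are its bimodule property.\<close>

definition Is :: "('x, 'b) mser \<Rightarrow> ('x, 'a) mser" where
  "Is F = MSer (\<lambda>xs. emb (coef F xs))"

definition Es :: "('x, 'a) mser \<Rightarrow> ('x, 'b) mser" where
  "Es F = MSer (\<lambda>xs. E (coef F xs))"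

lemma coef_Is: "coef (Is F) xs = emb (coef F xs)"
  by (simp add: Is_def)

lemma coef_Es: "coef (Es F) xs = E (coef F xs)"
  by (simp add: Es_def)

lemma Is_mult [simp]: "Is (F * G) = Is F * Is G"
  by (rule mser_eqI) (simp add: coef_Is coef_mult additive_conv[of emb])

lemma Is_add [simp]: "Is (F + G) = Is F + Is G"
  by (rule mser_eqI) (simp add: coef_Is)

lemma Is_1 [simp]: "Is 1 = 1"
  by (rule mser_eqI) (simp add: coef_Is coef_1)

lemma Es_add [simp]: "Es (F + G) = Es F + Es G"
  by (rule mser_eqI) (simp add: coef_Es)

lemma Es_1 [simp]: "Es 1 = 1"
  by (rule mser_eqI) (simp add: coef_Es coef_1)

lemma Es_left [simp]: "Es (Is F * G) = F * Es G"
  by (rule mser_eqI) (simp add: coef_Is coef_Es coef_mult additive_conv[of E])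

lemma Es_right [simp]: "Es (G * Is F) = Es G * F"
  by (rule mser_eqI) (simp add: coef_Is coef_Es coef_mult additive_conv[of E])

definition K :: "'a \<Rightarrow> ('b, 'b) mser" where
  "K c = MSer (\<lambda>xs. kap (map (\<lambda>x. emb x * c) xs))"

lemma coef_K: "coef (K c) xs = kap (map (\<lambda>x. emb x * c) xs)"
  by (simp add: K_def)

lemma coef_K_Nil [simp]: "coef (K c) [] = 0"
  by (simp add: coef_K kap_Nil)

lemma coef_K_single: "coef (K c) [x] = x * E c"
proof -
  have "kap [a] = E a" for a
    using lcomp_kap_momI[of "[a]"] by (simp add: lcomp_Cons mom_def)
  then show ?thesis by (simp add: coef_K)
qed

lemma multiadd_K: "multiadd (coef (K c))"
  unfolding multiadd_def
proof (intro allI impI)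
  fix xs ys zs :: "'b list" assume "sum_at xs ys zs"
  then have "sum_at (map (\<lambda>x. emb x * c) xs) (map (\<lambda>x. emb x * c) ys) (map (\<lambda>x. emb x * c) zs)"
    by (induction rule: sum_at.induct) (auto simp: distrib_right intro: sum_at.intros)
  then show "coef (K c) zs = coef (K c) xs + coef (K c) ys"
    by (simp add: coef_K multiaddD[OF multiadd_kap])
qed

lemma K_lhom: "lhom (\<lambda>x. y * x) (\<lambda>x. y * x) (coef (K c))"
  using lhomD[OF kap_lhom] by (simp add: lhom_def coef_K mult.assoc)

text \<open>The moment-cumulant relation, evaluated at \<open>\<chi>\<close>.\<close>
lemma Es_star:
  assumes \<chi>: "coef \<chi> [] = 0"
  shows "Es (star (Is \<chi> * cst c)) = 1 + cmp (K c) (Es (star (Is \<chi> * cst c)) * \<chi>)"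
proof (rule mser_eqI)
  fix xs
  define Z where "Z ys = emb (coef \<chi> ys) * c" for ys
  have Z: "coef (Is \<chi> * cst c) = Z"
    by (auto simp: Z_def coef_mult_cst coef_Is)
  have Z0: "Z [] = 0" by (simp add: Z_def \<chi>)
  let ?P = "Es (star (Is \<chi> * cst c))"
  have P: "coef ?P ys = lcomp mom Z ys" for ys
    by (simp add: coef_Es star_def Z lcomp_additive[of E] mom_def[abs_def])
  \<comment> \<open>As \<open>momI\<close> is mom \<cdot> I, substituting \<open>Z\<close> gives
    (mom \<circ> Z) \<cdot> Z, and \<open>Z\<close> is \<chi> followed by \<open>c\<close>.\<close>
  have "lcomp momI Z ys = emb (coef (?P * \<chi>) ys) * c" for ys
  proof -
    have "lcomp momI Z ys = conv (\<lambda>us vs. lcomp (\<lambda>ps. lcomp (\<lambda>qs. emb (mom ps) * lid qs) Z vs) Z us) ys"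
      unfolding momI_def by (rule lcomp_conv)
    also have "\<dots> = conv (\<lambda>us vs. emb (lcomp mom Z us) * Z vs) ys"
    proof (intro conv_cong)
      fix us vs
      have "lcomp (\<lambda>qs. emb z * lid qs) Z vs = emb z * Z vs" for z
        by (simp add: lcomp_additive[of "\<lambda>a. emb z * a", symmetric] distrib_left lcomp_lid_left Z0)
      then show "lcomp (\<lambda>ps. lcomp (\<lambda>qs. emb (mom ps) * lid qs) Z vs) Z us = emb (lcomp mom Z us) * Z vs"
        by (simp add: lcomp_additive[of "\<lambda>z. emb z * Z vs"] distrib_right)
    qed
    also have "\<dots> = emb (coef (?P * \<chi>) ys) * c"
      by (simp add: coef_mult P additive_conv[of "\<lambda>z. emb z * c"] distrib_right)
        (simp add: Z_def mult.assoc)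
    finally show ?thesis .
  qed
  then have g: "lcomp momI Z = (\<lambda>ys. emb (coef (?P * \<chi>) ys) * c)" by blast
  \<comment> \<open>The relation mom = 1 + \<kappa> \<circ> momI is composed with \<open>Z\<close>;
    associativity then brings in the formula for \<open>lcomp momI Z\<close>.\<close>
  have "mom = (\<lambda>as. (if as = [] then 1 else 0) + lcomp kap momI as)"
    by (auto simp: lcomp_kap_momI kap_Nil)
  then have "lcomp mom Z xs = lcomp (\<lambda>as. (if as = [] then 1 else 0) + lcomp kap momI as) Z xs"
    by simp
  also have "\<dots> = coef 1 xs + lcomp kap (lcomp momI Z) xs"
    by (simp add: lcomp_add lcomp_const coef_1 lcomp_assoc[OF multiadd_kap])
  also have "lcomp kap (lcomp momI Z) xs = coef (cmp (K c) (?P * \<chi>)) xs"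
    unfolding g by (simp add: coef_cmp coef_K[abs_def]
        lcomp_map[of kap "\<lambda>x. emb x * c" "coef (?P * \<chi>)"])
  finally show "coef ?P xs = coef (1 + cmp (K c) (?P * \<chi>)) xs"
    by (simp add: P)
qed

text \<open>Here (1 + \<tau>) \<chi> = \<tau> w, so the right-hand equation says that \<tau> is a
  solution of the fixed-point equation in \<open>Es_star\<close>, whose solution is unique. The
  variable \<tau> is T for \<open>b\<close> and \<open>a * b\<close>, but the conjugate t for
  \<open>a\<close>.\<close>

lemma Es_star_iff:
  assumes \<tau>: "coef \<tau> [] = 0" and r: "(1 + \<tau>) * r = 1"
  shows "Es (star (Is (r * \<tau> * w) * cst c)) = 1 + \<tau> \<longleftrightarrow> cmp (K c) (\<tau> * w) = \<tau>"
proof -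
  define \<chi> where "\<chi> = r * \<tau> * w"
  have \<chi>: "coef \<chi> [] = 0" by (simp add: \<chi>_def \<tau>)
  have e: "(1 + \<tau>) * \<chi> = \<tau> * w"
    by (simp add: \<chi>_def mult.assoc[symmetric] r)
  define \<phi> where "\<phi> = Es (star (Is \<chi> * cst c)) - 1"
  have \<phi>: "\<phi> = cmp (K c) ((1 + \<phi>) * \<chi>)"
    using Es_star[OF \<chi>, of c] by (simp add: \<phi>_def algebra_simps)
  have "\<phi> = \<tau> \<longleftrightarrow> cmp (K c) (\<tau> * w) = \<tau>"
  proof
    assume "\<phi> = \<tau>"
    with \<phi> e show "cmp (K c) (\<tau> * w) = \<tau>" by simp
  next
    assume "cmp (K c) (\<tau> * w) = \<tau>"
    then have "\<tau> = cmp (K c) ((1 + \<tau>) * \<chi>)" by (simp add: e)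
    from fixpoint_unique[OF \<chi> \<phi> this] show "\<phi> = \<tau>" .
  qed
  moreover have "\<phi> = \<tau> \<longleftrightarrow> Es (star (Is \<chi> * cst c)) = 1 + \<tau>"
    by (auto simp: \<phi>_def algebra_simps)
  ultimately show ?thesis by (simp only: \<chi>_def)
qed

abbreviation alg :: "'a \<Rightarrow> 'a set" where
  "alg \<equiv> balg sA lact ract"

lemma emb_in_alg: "emb x \<in> alg c"
  unfolding emb_def by (intro balg.lmod balg.one)

lemma zero_in_alg [simp]: "0 \<in> alg c"
  using emb_in_alg[of 0 c] by simp

definition series_in :: "'a set \<Rightarrow> ('x, 'a) mser \<Rightarrow> bool" where
  "series_in S F \<longleftrightarrow> (\<forall>xs. coef F xs \<in> S)"

lemma series_in_mult:
  fixes F G :: "('x, 'a) mser"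
  assumes "series_in (alg c) F" "series_in (alg c) G"
  shows "series_in (alg c) (F * G)"
proof -
  have "conv h xs \<in> alg c" if "\<And>us vs. us @ vs = xs \<Longrightarrow> h us vs \<in> alg c" for h and xs :: "'x list"
    using that
  proof (induction xs arbitrary: h)
    case (Cons x xs)
    have "h [] (x # xs) \<in> alg c" "conv (\<lambda>us. h (x # us)) xs \<in> alg c"
      using Cons by auto
    then show ?case by (auto simp: conv_Cons intro: balg.add)
  qed simp
  then show ?thesis using assms by (simp add: series_in_def coef_mult balg.mult)
qed

lemma series_in_add: "series_in (alg c) F \<Longrightarrow> series_in (alg c) G \<Longrightarrow> series_in (alg c) (F + G)"
  by (auto simp: series_in_def intro: balg.add)

lemma series_in_Is: "series_in (alg c) (Is F)"
  by (auto simp: series_in_def coef_Is emb_in_alg)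

lemma series_in_cst: "series_in (alg c) (cst c)"
  by (auto simp: series_in_def coef_cst balg.gen)

lemma series_in_diff_1:
  assumes "series_in (alg c) F"
  shows "series_in (alg c) (F - 1)"
proof -
  have "emb (- x) = - emb x" for x
    by (metis emb_add emb_0 add.left_inverse eq_neg_iff_add_eq_0)
  then have "F - 1 = F + Is (- 1)"
    by (intro mser_eqI) (simp add: coef_Is coef_1)
  then show ?thesis using assms series_in_add series_in_Is by metis
qed

lemma series_in_star:
  assumes "series_in (alg c) F"
  shows "series_in (alg c) (star F)"
proof -
  have "lcomp f (coef F) xs \<in> alg c"
    if "\<And>ys. set ys \<subseteq> alg c \<Longrightarrow> f ys \<in> alg c" for f xs
    using that
  proof (induction xs arbitrary: f rule: lcomp_induct)
    case (Cons x xs)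
    have "lcomp (\<lambda>ys. f (coef F (x # take k xs) # ys)) (coef F) (drop k xs) \<in> alg c" for k
      using assms by (intro Cons) (auto simp: series_in_def)
    moreover have "(\<Sum>i\<in>I. h i) \<in> alg c" if "\<And>i. h i \<in> alg c" for h and I :: "nat set"
      using that by (induction I rule: infinite_finite_induct) (auto intro: balg.add)
    ultimately show ?case by (simp add: lcomp.simps(2))
  qed auto
  moreover have "prod_list ys \<in> alg c" if "set ys \<subseteq> alg c" for ys
    using that by (induction ys) (auto intro: balg.mult balg.one)
  ultimately show ?thesis by (auto simp: series_in_def star_def)
qed

end

section \<open>Resolvents of products of free elements\<close>

locale free_pair = bprob sB sA lact ract E
  for sB :: "'k::field_char_0 \<Rightarrow> 'b::ring_1 \<Rightarrow> 'b"
    and sA :: "'k \<Rightarrow> 'a::ring_1 \<Rightarrow> 'a"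
    and lact :: "'b \<Rightarrow> 'a \<Rightarrow> 'a"
    and ract :: "'a \<Rightarrow> 'b \<Rightarrow> 'a"
    and E :: "'a \<Rightarrow> 'b" +
  fixes a b :: 'a
  assumes free: "free sA lact ract E a b"
begin

abbreviation side :: "bool \<Rightarrow> 'a set" where
  "side j \<equiv> alg (if j then a else b)"

lemma free_prod_list:
  assumes "as \<noteq> []" "list_all2 (\<lambda>u j. E u = 0 \<and> u \<in> side j) as js" "distinct_adj js"
  shows "E (prod_list as) = 0"
  using free[unfolded free_def, rule_format, of as js] assms
  by (auto simp: list_all2_conv_all_nth distinct_adj_conv_nth Suc_le_eq)

text \<open>A coefficient of the product is a sum of words in coefficients, and
  \<open>Es F = 0\<close> centres every coefficient of \<open>F\<close>. The induction moves factors
  from \<open>Fs\<close> one at a time into the list \<open>us\<close> of chosen coefficients, until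
  freeness applies to \<open>us\<close> alone.\<close>

lemma free_series:
  assumes "Fs \<noteq> []" "list_all2 (\<lambda>F j. Es F = 0 \<and> series_in (side j) F) Fs js" "distinct_adj js"
  shows "Es (prod_list Fs) = 0"
proof -
  have "E (prod_list us * coef (prod_list Fs) xs) = 0"
    if "us \<noteq> [] \<or> Fs \<noteq> []" "list_all2 (\<lambda>u j. E u = 0 \<and> u \<in> side j) us ks"
      "list_all2 (\<lambda>F j. Es F = 0 \<and> series_in (side j) F) Fs js" "distinct_adj (ks @ js)"
    for us ks js xs
    using that
  proof (induction Fs arbitrary: us ks js xs)
    case Nil
    then have "E (prod_list us) = 0" by (intro free_prod_list) auto
    then show ?case by (simp add: coef_1)
  next
    case (Cons F Fs)
    from Cons.prems(3) obtain j js' where js: "js = j # js'" by (cases js) auto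
    have "E (prod_list us * (coef F vs * coef (prod_list Fs) ws)) = 0" for vs ws
    proof -
      have "E (coef F vs) = 0" using Cons.prems(3) js by (simp flip: coef_Es)
      then have "list_all2 (\<lambda>u j. E u = 0 \<and> u \<in> side j) (us @ [coef F vs]) (ks @ [j])"
        using Cons.prems(3) js
        by (intro list_all2_appendI[OF Cons.prems(2)]) (auto simp: series_in_def)
      then have "E (prod_list (us @ [coef F vs]) * coef (prod_list Fs) ws) = 0"
        using Cons.prems(3,4) js by (intro Cons.IH[of _ "ks @ [j]" js']) simp_all
      then show ?thesis by (simp add: mult.assoc)
    qed
    then show ?case
      by (simp add: coef_mult additive_conv[of "\<lambda>z. E (prod_list us * z)"] distrib_left)
  qed
  from this[of "[]" "[]" js] assms show ?thesis
    by (intro mser_eqI) (auto simp: coef_Es)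
qed

text \<open>The centred series \<open>a\<^sub>1 = A\<^sub>1 (1 - T A\<^sub>1)\<inverse>\<close> and \<open>c\<^sub>1 = C\<^sub>1 (1 - T C\<^sub>1)\<inverse>\<close> turn
  \<open>1 - T ((1 + A\<^sub>1) (1 + C\<^sub>1) - 1)\<close> into \<open>1 - T a\<^sub>1 (1 + T) c\<^sub>1\<close> up to the outer factors
  \<open>1 + T a\<^sub>1\<close> and \<open>1 + T c\<^sub>1\<close>; all words in the resulting geometric series alternate.\<close>
lemma Es_star_product:
  fixes A C :: "('b, 'a) mser"
  assumes A: "series_in (alg a) A" and C: "series_in (alg b) C"
    and EA: "Es (star (Is TT * (A - 1))) = 1" and EC: "Es (star (Is TT * (C - 1))) = 1"
  shows "Es (star (Is TT * (A * C - 1))) = 1"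
proof -
  define z where "z = (Is TT :: ('b, 'a) mser)"
  define A1 where "A1 = A - 1"
  define C1 where "C1 = C - 1"
  define W1 where "W1 = star (z * A1)"
  define W2 where "W2 = star (z * C1)"
  define D where "D = A * C - 1"
  have z0: "coef z [] = 0" by (simp add: z_def coef_Is)
  then have z0m: "coef (z * F) [] = 0" for F by simp
  have W1: "W1 = 1 + z * A1 * W1" "W1 * (z * A1) = W1 - 1" "(1 - z * A1) * W1 = 1"
    using star_unfold[OF z0m[of A1]] star_unfold_right[OF z0m[of A1]] star_right_inverse[OF z0m[of A1]]
    by (simp_all add: W1_def algebra_simps)
  have W2: "W2 = 1 + z * C1 * W2" "z * (C1 * W2) = W2 - 1"
    using star_unfold[OF z0m[of C1]] by (simp_all add: W2_def algebra_simps)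
  \<comment> \<open>Taking expectations in star (z F) = 1 + z F star (z F) leaves T times the claim,
    and T can be cancelled on the left.\<close>
  have centred: "Es (F * star (z * F)) = 0" if "Es (star (z * F)) = 1" for F
  proof -
    have "Es (star (z * F)) = 1 + TT * Es (F * star (z * F))"
      using arg_cong[OF star_unfold[OF z0m[of F]], of Es] by (simp add: z_def mult.assoc)
    then have "TT * Es (F * star (z * F)) = TT * 0" using that by simp
    then show ?thesis by (rule TT_mult_cancel)
  qed
  \<comment> \<open>Inner words alternate between \<open>X\<close> and \<open>Y\<close>, while the
    outer factor \<open>W2\<close> is 1 + \<open>Y'\<close>. Its letter carries T in place of 1 + T,
    hence the separate name.\<close>
  define X where "X = z * (A1 * W1)"
  define Y where "Y = (1 + z) * (C1 * W2)"
  define Y' where "Y' = z * (C1 * W2)"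
  have one_z: "1 + z = Is (1 + TT)" by (simp add: z_def)
  have EX: "Es X = 0" "Es Y = 0" "Es Y' = 0"
    using centred[of A1] centred[of C1] EA EC
    by (simp_all add: X_def Y_def Y'_def one_z del: Is_add)
      (simp_all add: W1_def W2_def A1_def C1_def z_def)
  have inX: "series_in (alg a) X"
    unfolding X_def W1_def A1_def z_def
    by (intro series_in_mult series_in_star series_in_Is series_in_diff_1 A)
  have inY: "series_in (alg b) Y" "series_in (alg b) Y'"
    unfolding Y_def Y'_def W2_def C1_def one_z unfolding z_def
    by (intro series_in_mult series_in_star series_in_Is series_in_diff_1 C)+
  have WX: "W1 = 1 + X" and WY: "W2 = 1 + Y'"
    using W1(1) W2(2) by (simp_all add: X_def Y'_def mult.assoc)
  have XY_eq: "X * Y = (W1 - 1) * (C1 * W2) + (W1 - 1) * (W2 - 1)"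
    using W2(2) by (simp add: WX Y_def distrib_left distrib_right mult.assoc)
  \<comment> \<open>With D = A1 + C1 + A1 C1, expanding leaves 1 minus (W1 - 1)(W2 - 1) = X z C1 W2
    and minus X C1 W2; together they account for the factor 1 + z in \<open>Y\<close>.\<close>
  have "W1 * (z * D) * W2 = (W1 * (z * A1)) * W2 + W1 * (z * (C1 * W2)) + (W1 * (z * A1)) * (C1 * W2)"
    by (simp add: D_def A1_def C1_def algebra_simps)
  then have D_eq: "W1 * (z * D) * W2 = (W1 - 1) * W2 + W1 * (W2 - 1) + (W1 - 1) * (C1 * W2)"
    unfolding W1(2) W2(2) .
  have "W1 * (1 - z * D) * W2 = W1 * W2 - W1 * (z * D) * W2"
    by (simp add: left_diff_distrib right_diff_distrib)
  then have key: "W1 * (1 - z * D) * W2 = 1 - X * Y"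
    unfolding D_eq XY_eq by (simp add: algebra_simps)
  have XY: "coef (X * Y) [] = 0" by (simp add: X_def z0)
  define G where "G = star (X * Y)"
  have "(1 - z * D) * (W2 * G * W1) = (1 - z * A1) * (W1 * (1 - z * D) * W2) * G * W1"
    by (simp add: mult.assoc[symmetric] W1(3))
  also have "\<dots> = (1 - z * A1) * ((1 - X * Y) * G) * W1"
    by (simp only: key[symmetric] mult.assoc)
  also have "\<dots> = 1" by (simp add: G_def star_right_inverse[OF XY] W1(3))
  finally have st: "star (z * D) = W2 * G * W1"
    by (rule star_unique[OF z0m, symmetric])
  let ?f = "\<lambda>j. if j then X else Y"
  have sides: "Es (?f j) = 0 \<and> series_in (side j) (?f j)" for j
    using EX inX inY by auto
  then have all: "list_all2 (\<lambda>F j. Es F = 0 \<and> series_in (side j) F) (map ?f js) js" for js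
    by (simp add: list_all2_conv_all_nth)
  have word: "Es (prod_list (map ?f (alts True (Suc n)))) = 0" for n
    by (rule free_series[OF _ all distinct_adj_alts(1)]) simp
  have word': "Es (Y' * prod_list (map ?f (alts True n))) = 0" for n
    using free_series[of "Y' # map ?f (alts True n)" "False # alts True n"] all EX inY
      distinct_adj_alts(2)[of True n] by simp
  have term_i: "Es (W2 * (X * Y) ^ i * W1) = (if i = 0 then 1 else 0)" for i
  proof -
    have e: "W2 * (X * Y) ^ i * W1
        = (X * Y) ^ i + (X * Y) ^ i * X + Y' * (X * Y) ^ i + Y' * ((X * Y) ^ i * X)"
      by (simp add: WX WY algebra_simps)
    have "Es ((X * Y) ^ i) = (if i = 0 then 1 else 0)"
      using word[of "2 * (i - 1) + 1"] alternating_power(1)[of X Y i] by (cases i) simp_all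
    then show ?thesis
      unfolding e using word[of "2 * i"] word'[of "2 * i"] word'[of "Suc (2 * i)"]
      by (simp only: alternating_power Es_add) simp
  qed
  \<comment> \<open>At a fixed list the geometric series may be cut off, because powers of
    \<open>X * Y\<close> beyond its length have no coefficient there. Of the remaining words only
    the empty one has nonzero expectation.\<close>
  have "coef (Es (W2 * G * W1)) xs = coef 1 xs" for xs
  proof -
    let ?n = "Suc (length xs)"
    have "coef (W2 * ((X * Y) ^ ?n * (G * W1))) xs = conv (\<lambda>us vs. 0) xs"
      unfolding coef_mult[of W2]
      by (intro conv_cong) (auto simp del: power_Suc simp: coef_power_eq_0[OF XY])
    then have 0: "coef (W2 * (X * Y) ^ ?n * G * W1) xs = 0" by (simp add: mult.assoc)
    have "W2 * G * W1 = W2 * ((\<Sum>i<?n. (X * Y) ^ i) + (X * Y) ^ ?n * G) * W1"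
      unfolding G_def using star_geometric[OF XY, of ?n] by metis
    also have "\<dots> = (\<Sum>i<?n. W2 * (X * Y) ^ i * W1) + W2 * (X * Y) ^ ?n * G * W1"
      by (simp only: distrib_left distrib_right sum_distrib_left sum_distrib_right mult.assoc)
    finally have "coef (Es (W2 * G * W1)) xs = E (\<Sum>i<?n. coef (W2 * (X * Y) ^ i * W1) xs)"
      using 0 by (simp add: coef_Es coef_sum del: sum.lessThan_Suc power_Suc)
    also have "\<dots> = (\<Sum>i<?n. E (coef (W2 * (X * Y) ^ i * W1) xs))"
    proof -
      have "E (sum h I) = (\<Sum>i\<in>I. E (h i))" for h and I :: "nat set"
        by (induction I rule: infinite_finite_induct) auto
      then show ?thesis .
    qed
    also have "\<dots> = (\<Sum>i<?n. coef (if i = 0 then 1 else 0) xs)"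
      by (simp only: term_i[symmetric] coef_Es)
    also have "\<dots> = coef 1 xs"
      by (subst sum.lessThan_Suc_shift) simp
    finally show ?thesis .
  qed
  then have "Es (W2 * G * W1) = 1" by (rule mser_eqI)
  then show ?thesis using st by (simp add: z_def D_def)
qed

end

section \<open>The S-transform\<close>

definition hat :: "'b mseq \<Rightarrow> ('b, 'b) mser" where
  "hat f = MSer (\<lambda>xs. f (length xs) xs)"

lemma coef_hat: "coef (hat f) xs = f (length xs) xs"
  by (simp add: hat_def)

lemma seq_eq_iff_hat: "seq_eq f g \<longleftrightarrow> hat f = hat g"
  by (auto simp: seq_eq_def coef_hat[symmetric] intro!: mser_eqI)

lemma hat_mone: "hat mone = 1"
  by (rule mser_eqI) (simp add: coef_hat mone_def coef_1)

lemma hat_mI: "hat mI = TT"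
  by (rule mser_eqI) (simp add: coef_hat mI_def coef_TT lid_def)

lemma hat_mprod: "hat (mprod f g) = hat f * hat g"
  by (rule mser_eqI) (auto simp: coef_hat mprod_def coef_mult conv_def intro!: sum.cong)

lemma compositions_0: "compositions 0 = {[]}"
proof -
  have "ks = []" if "0 \<notin> set ks" "sum_list ks = 0" for ks :: "nat list"
    using that by (cases ks) auto
  then show ?thesis by (auto simp: compositions_def)
qed

lemma compositions_Suc:
  "compositions (Suc n) = (\<lambda>(k, ks). Suc k # ks) ` Sigma {..n} (\<lambda>k. compositions (n - k))"
proof (rule set_eqI)
  fix ks
  show "ks \<in> compositions (Suc n)
      \<longleftrightarrow> ks \<in> (\<lambda>(k, ks). Suc k # ks) ` Sigma {..n} (\<lambda>k. compositions (n - k))"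
  proof (cases ks)
    case (Cons m ms)
    then show ?thesis
      by (cases m) (auto simp: compositions_def image_iff)
  qed (auto simp: compositions_def)
qed

lemma finite_compositions: "finite (compositions n)"
proof (induction n rule: less_induct)
  case (less n)
  show ?case
  proof (cases n)
    case (Suc m)
    then show ?thesis using less by (auto simp: compositions_Suc)
  qed (simp add: compositions_0)
qed

lemma length_splits [simp]: "length (splits ks xs) = length ks"
  by (induction ks xs rule: splits.induct) auto

lemma sum_compositions_lcomp:
  "(\<Sum>ks\<in>compositions (length xs). F (map (\<lambda>(k, ys). g k ys) (zip ks (splits ks xs))))
    = lcomp F (\<lambda>ys. g (length ys) ys) xs"
proof (induction xs arbitrary: F rule: lcomp_induct)
  case Nil
  then show ?case by (simp add: compositions_0)
next
  case (Cons x xs)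
  let ?G = "\<lambda>ks. F (map (\<lambda>(k, ys). g k ys) (zip ks (splits ks (x # xs))))"
  have "(\<Sum>ks\<in>compositions (Suc (length xs)). ?G ks)
      = (\<Sum>(k, ks)\<in>Sigma {..length xs} (\<lambda>k. compositions (length xs - k)). ?G (Suc k # ks))"
    unfolding compositions_Suc
    by (subst sum.reindex) (auto simp: inj_on_def intro!: sum.cong)
  also have "\<dots> = (\<Sum>k\<le>length xs. \<Sum>ks\<in>compositions (length xs - k). ?G (Suc k # ks))"
    by (subst sum.Sigma) (auto simp: finite_compositions)
  also have "\<dots> = lcomp F (\<lambda>ys. g (length ys) ys) (x # xs)"
  proof (subst lcomp.simps, intro sum.cong refl)
    fix k assume k: "k \<in> {..length xs}"
    have "(\<Sum>ks\<in>compositions (length (drop k xs)).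
        F (g (Suc k) (x # take k xs) # map (\<lambda>(k, ys). g k ys) (zip ks (splits ks (drop k xs)))))
        = lcomp (\<lambda>ys. F (g (Suc k) (x # take k xs) # ys)) (\<lambda>ys. g (length ys) ys) (drop k xs)"
      using k by (intro Cons.IH) auto
    then show "(\<Sum>ks\<in>compositions (length xs - k). ?G (Suc k # ks))
        = lcomp (\<lambda>ys. F (g (length (x # take k xs)) (x # take k xs) # ys))
            (\<lambda>ys. g (length ys) ys) (drop k xs)"
      using k by (simp add: min_def)
  qed
  finally show ?case by simp
qed

lemma hat_mcomp: "hat (mcomp f g) = cmp (hat f) (hat g)"
proof (rule mser_eqI)
  fix xs
  show "coef (hat (mcomp f g)) xs = coef (cmp (hat f) (hat g)) xs"
    using sum_compositions_lcomp[of "\<lambda>ys. f (length ys) ys" g xs]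
    by (simp add: coef_hat mcomp_def coef_cmp hat_def)
qed

text \<open>\<open>minv\<close> and \<open>compinv\<close> single out sequences that vanish on lists
  of the wrong length; this is that representative of a series.\<close>

definition of_mser :: "('b, 'b::zero) mser \<Rightarrow> 'b mseq" where
  "of_mser F n xs = (if length xs = n then coef F xs else 0)"

lemma hat_of_mser [simp]: "hat (of_mser F) = F"
  by (rule mser_eqI) (simp add: coef_hat of_mser_def)

lemma normalized_of_mser: "normalized (of_mser F)"
  by (simp add: normalized_def of_mser_def)

lemma of_mser_hat: "normalized f \<Longrightarrow> of_mser (hat f) = f"
  by (intro ext) (auto simp: of_mser_def coef_hat normalized_def)

lemma hat_minv:
  assumes "hat f * G = 1" "G * hat f = 1"
  shows "hat (minv f) = G"
proof -
  have "minv f = of_mser G"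
    unfolding minv_def
  proof (rule the_equality)
    fix h assume h: "normalized h \<and> seq_eq (mprod f h) mone \<and> seq_eq (mprod h f) mone"
    then have "hat f * hat h = 1" by (simp add: seq_eq_iff_hat hat_mprod hat_mone)
    then have "hat h = G" by (metis assms(2) mult.assoc mult_1 mult_1_right)
    then show "h = of_mser G" using h by (auto simp: of_mser_hat)
  qed (use assms in \<open>simp add: seq_eq_iff_hat hat_mprod hat_mone normalized_of_mser\<close>)
  then show ?thesis by simp
qed

section \<open>S-transforms as solutions of one equation\<close>

context bprob
begin

lemma hat_kseq: "hat (kseq lact E c) = K c"
proof -
  have "cumulants lact E 0 [] = 0" using kap_Nil by (simp add: kap_def)
  then show ?thesis
    by (intro mser_eqI) (auto simp: coef_hat kseq_def coef_K kap_def lact_emb[of _ c])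
qed

lemma K_inj: "bunit (E c) \<Longrightarrow> coef (K c) [x] = coef (K c) [y] \<Longrightarrow> x = y"
  unfolding coef_K_single bunit_def by (metis mult.assoc mult_1_right)

lemma K_right_inverse_unique:
  assumes "bunit (E c)" "cmp (K c) H = TT" "cmp (K c) H' = TT" "coef H [] = coef H' []"
  shows "H = H'"
proof (rule mser_eqI)
  fix xs
  show "coef H xs = coef H' xs"
    by (rule lcomp_right_inverse_unique[of "coef (K c)"])
      (simp_all only: coef_cmp[symmetric] coef_TT[symmetric] assms K_inj[OF assms(1)])
qed

text \<open>The linear part of \<open>K c\<close> is right multiplication by \<open>E c\<close>,
  inverted by \<open>e\<close>. The compositional inverse stays left linear in its first argument,
  so T can be factored out, and the constant term of the cofactor is \<open>e\<close>.\<close>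

lemma ex_S:
  assumes "bunit (E c)"
  obtains S where "cmp (K c) (TT * S) = TT" "cmp (TT * S) (K c) = TT" "bunit (coef S [])"
proof -
  from assms obtain e where e: "E c * e = 1" "e * E c = 1" by (auto simp: bunit_def)
  obtain h where h: "h [] = 0" "lcomp (coef (K c)) h = lid" "lcomp h (coef (K c)) = lid"
    using composition_inverse[of "coef (K c)" "\<lambda>x. x * e"] multiadd_K
    by (auto simp: coef_K_single mult.assoc e)
  have lh: "lhom (\<lambda>x. y * x) (\<lambda>x. y * x) h" for y
    by (rule lhom_inverse[OF h(2) K_lhom K_inj[OF assms]]) (simp_all add: distrib_left)
  define S where "S = MSer (\<lambda>xs. h (1 # xs))"
  have TS: "coef (TT * S) = h"
  proof
    fix xs show "coef (TT * S) xs = h xs"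
    proof (cases xs)
      case (Cons x xs')
      then show ?thesis using lhomD[OF lh[of x], of 1 xs'] by (simp add: S_def)
    qed (simp add: h)
  qed
  have "h [1] * E c = 1"
    using fun_cong[OF h(2), of "[1]"] by (simp add: lcomp_Cons coef_K_single)
  then have "h [1] = e" by (metis e(1) mult.assoc mult_1 mult_1_right)
  then have "bunit (coef S [])" using e by (auto simp: S_def bunit_def)
  moreover have "cmp (K c) (TT * S) = TT" "cmp (TT * S) (K c) = TT"
    by (auto intro!: mser_eqI simp: coef_cmp TS h coef_TT)
  ultimately show ?thesis using that by blast
qed

text \<open>Right inverses without constant term are unique, so the one equation assumed for
  \<open>S\<close> already identifies \<open>T * S\<close> with the two-sided inverse from
  \<open>ex_S\<close>.\<close>

lemma hat_S_el:
  assumes c: "bunit (E c)" and S: "cmp (K c) (TT * S) = TT"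
  shows "hat (S_el lact E c) = S"
proof -
  obtain S' where S': "cmp (K c) (TT * S') = TT" "cmp (TT * S') (K c) = TT" "bunit (coef S' [])"
    using ex_S[OF c] .
  have "TT * S = TT * S'"
    by (rule K_right_inverse_unique[OF c S S'(1)]) simp
  then have SS': "S = S'" by (rule TT_mult_cancel)
  have "compinv (kseq lact E c) = of_mser (TT * S')"
    unfolding compinv_def seq_eq_iff_hat hat_mcomp hat_kseq hat_mI
  proof (rule the_equality)
    have "in_GI (of_mser (TT * S'))"
      unfolding in_GI_def
      using S'(3) by (intro conjI normalized_of_mser exI[of _ "of_mser S'"])
        (auto simp: of_mser_def in_Ginv_def)
    then show "in_GI (of_mser (TT * S')) \<and> cmp (K c) (hat (of_mser (TT * S'))) = TT
        \<and> cmp (hat (of_mser (TT * S'))) (K c) = TT"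
      using S' by simp
  next
    fix h assume h: "in_GI h \<and> cmp (K c) (hat h) = TT \<and> cmp (hat h) (K c) = TT"
    then have "hat h = TT * S'"
      by (intro K_right_inverse_unique[OF c _ S'(1)]) (auto simp: coef_hat in_GI_def)
    then show "h = of_mser (TT * S')" using h by (metis of_mser_hat in_GI_def)
  qed
  then show ?thesis
    by (intro mser_eqI) (simp add: coef_hat S_el_def S_transform_def of_mser_def SS')
qed

text \<open>From 1 - r T A = r (1 - T (A - 1)) the two resolvents differ by the right factor 1 + T,
  which passes through \<open>Es\<close> and is invertible. The form with \<open>A - 1\<close> is
  the one suited to centring.\<close>

lemma Es_star_shift:
  fixes A :: "('b, 'a) mser"
  assumes r: "(1 + TT) * r = 1" "r * (1 + TT) = 1"
  shows "Es (star (Is (r * TT) * A)) = 1 + TT \<longleftrightarrow> Es (star (Is TT * (A - 1))) = 1"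
proof -
  let ?z = "Is TT :: ('b, 'a) mser" and ?q = "Is (1 + TT) :: ('b, 'a) mser"
  let ?W = "star (?z * (A - 1))"
  have z: "coef (?z * (A - 1)) [] = 0" by (simp add: coef_Is)
  have rq: "Is r * ?q = 1" using arg_cong[OF r(2), of Is] by simp
  then have "1 - Is (r * TT) * A = Is r * (1 - ?z * (A - 1))"
    by (simp add: algebra_simps)
  then have "(1 - Is (r * TT) * A) * (?W * ?q) = Is r * ((1 - ?z * (A - 1)) * ?W) * ?q"
    by (simp only: mult.assoc)
  also have "\<dots> = 1" by (simp add: star_right_inverse[OF z] rq del: Is_add)
  finally have "?W * ?q = star (Is (r * TT) * A)"
    by (intro star_unique) (simp add: coef_Is)
  then have e: "Es (star (Is (r * TT) * A)) = Es ?W * (1 + TT)"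
    by (metis Es_right)
  show ?thesis unfolding e
  proof
    assume "Es ?W * (1 + TT) = 1 + TT"
    then have "Es ?W * ((1 + TT) * r) = (1 + TT) * r" by (simp only: mult.assoc[symmetric])
    then show "Es ?W = 1" by (simp only: r mult_1_right)
  qed simp
qed

end

section \<open>The product formula at the level of series\<close>

lemma (in free_pair) S_product:
  fixes Sa Sb Sb' :: "('b, 'b) mser"
  assumes Sa: "cmp (K a) (TT * Sa) = TT" and Sb: "cmp (K b) (TT * Sb) = TT"
    and inv: "Sb * Sb' = 1" "Sb' * Sb = 1"
  shows "cmp (K (a * b)) (TT * (Sb * cmp Sa (Sb' * TT * Sb))) = TT"
proof -
  define t where "t = Sb' * TT * Sb"
  define u where "u = cmp Sa t"
  define r :: "('b, 'b) mser" where "r = star (- TT)"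
  have r: "(1 + TT) * r = 1" "r * (1 + TT) = 1"
    unfolding r_def by (rule one_add_unit, simp)+
  have t0: "coef t [] = 0" by (simp add: t_def)
  \<comment> \<open>Substitution is multiplicative, so \<open>t * u\<close> is T S_a with t
    substituted for T, and associativity reduces the claim to the equation for
    \<open>Sa\<close>.\<close>
  have "cmp (K a) (t * u) = cmp (K a) (cmp (TT * Sa) t)"
    by (simp add: cmp_mult cmp_TT_left t0 u_def)
  also have "\<dots> = t"
    by (simp add: cmp_assoc[OF multiadd_K] Sa cmp_TT_left t0)
  finally have Ka: "cmp (K a) (t * u) = t" .
  have t1: "1 + t = Sb' * (1 + TT) * Sb"
    by (simp add: t_def distrib_left distrib_right inv)
  have r': "(1 + t) * (Sb' * r * Sb) = 1"
  proof -
    have "(1 + t) * (Sb' * r * Sb) = Sb' * ((1 + TT) * ((Sb * Sb') * r)) * Sb"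
      by (simp only: t1 mult.assoc)
    then show ?thesis by (simp add: inv r)
  qed
  define s where "s = (Is Sb :: ('b, 'a) mser)"
  define s' where "s' = (Is Sb' :: ('b, 'a) mser)"
  have s: "s * s' = 1" "s' * s = 1" by (simp_all add: s_def s'_def inv flip: Is_mult)
  define A where "A = s * Is u * cst a * s'"
  define C where "C = s * cst b"
  have "Es (star (Is (Sb' * r * Sb * t * u) * cst a)) = 1 + t"
    using Es_star_iff[OF t0 r'] Ka by blast
  \<comment> \<open>The inner \<open>Sb * Sb'\<close> cancels, which exhibits the coefficient as the
    conjugate of p = r T.\<close>
  also have "Sb' * r * Sb * t * u = Sb' * (r * TT) * Sb * u"
  proof -
    have "Sb' * r * Sb * t * u = Sb' * r * ((Sb * Sb') * TT * Sb) * u"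
      by (simp only: t_def mult.assoc)
    then show ?thesis by (simp add: inv mult.assoc)
  qed
  finally have Ea: "Es (star (Is (Sb' * (r * TT) * Sb * u) * cst a)) = 1 + t" .
  let ?Z = "Is (Sb' * (r * TT) * Sb * u) * cst a :: ('b, 'a) mser"
  have Z0: "coef ?Z [] = 0" by (simp add: coef_Is)
  have "Is (r * TT) * A = s * ?Z * s'"
  proof -
    have "s * ?Z * s' = (s * s') * Is (r * TT) * (s * Is u * cst a * s')"
      by (simp add: s_def s'_def mult.assoc)
    then show ?thesis by (simp add: s A_def)
  qed
  moreover have "s * star ?Z * s' = star (s * ?Z * s')"
  proof (rule star_unique)
    have "(1 - s * ?Z * s') * (s * star ?Z * s') = s * ((1 - ?Z * (s' * s)) * star ?Z) * s'"
      by (simp add: algebra_simps)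
    then show "(1 - s * ?Z * s') * (s * star ?Z * s') = 1"
      by (simp only: s mult_1_right star_right_inverse[OF Z0])
  qed (simp add: coef_Is)
  ultimately have "Es (star (Is (r * TT) * A)) = Es (s * star ?Z * s')" by simp
  also have "\<dots> = Sb * (1 + t) * Sb'" by (simp add: s_def s'_def Ea del: Is_mult)
  also have "\<dots> = (Sb * Sb') * (1 + TT) * (Sb * Sb')" by (simp only: t1 mult.assoc)
  also have "\<dots> = 1 + TT" by (simp add: inv)
  finally have EA: "Es (star (Is TT * (A - 1))) = 1" by (simp only: Es_star_shift[OF r])
  have "Es (star (Is (r * TT * Sb) * cst b)) = 1 + TT"
    using Es_star_iff[OF coef_TT_Nil r(1)] Sb by blast
  then have "Es (star (Is (r * TT) * C)) = 1 + TT"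
    by (simp add: C_def s_def mult.assoc)
  then have EC: "Es (star (Is TT * (C - 1))) = 1" by (simp only: Es_star_shift[OF r])
  have "series_in (alg a) A" "series_in (alg b) C"
    unfolding A_def C_def s_def s'_def
    by (intro series_in_mult series_in_Is series_in_cst)+
  then have "Es (star (Is (r * TT) * (A * C))) = 1 + TT"
    using Es_star_product[OF _ _ EA EC] by (simp only: Es_star_shift[OF r])
  \<comment> \<open>The trailing \<open>s'\<close> of \<open>A\<close> meets the leading
    \<open>s\<close> of \<open>C\<close>; this cancellation is what the conjugation was arranged
    for.\<close>
  also have "A * C = s * Is u * cst a * (s' * s) * cst b"
    by (simp only: A_def C_def mult.assoc)
  also have "\<dots> = Is (Sb * u) * cst (a * b)"
    unfolding s by (simp add: s_def cst_mult mult.assoc)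
  finally have "Es (star (Is (r * TT * (Sb * u)) * cst (a * b))) = 1 + TT"
    by (simp add: mult.assoc)
  then show ?thesis
    unfolding Es_star_iff[OF coef_TT_Nil r(1)] u_def t_def .
qed

theorem theorem4p4:
  fixes sB :: "'k::field_char_0 \<Rightarrow> 'b::ring_1 \<Rightarrow> 'b"
    and sA :: "'k \<Rightarrow> 'a::ring_1 \<Rightarrow> 'a"
    and lact :: "'b \<Rightarrow> 'a \<Rightarrow> 'a"
    and ract :: "'a \<Rightarrow> 'b \<Rightarrow> 'a"
    and E :: "'a \<Rightarrow> 'b"
    and a b :: 'a
  assumes "bprob_space sB sA lact ract E"
    and "free sA lact ract E a b"
    and "bunit (E a)" and "bunit (E b)"
  shows "\<forall>n xs. length xs = n \<longrightarrow>
    S_el lact E (a * b) n xs =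
    mprod (S_el lact E b)
      (mcomp (S_el lact E a) (mprod (mprod (minv (S_el lact E b)) mI) (S_el lact E b))) n xs"
proof -
  interpret free_pair sB sA lact ract E a b
    by unfold_locales (fact assms)+
  obtain Sa where Sa: "cmp (K a) (TT * Sa) = TT" "bunit (coef Sa [])"
    using ex_S[OF assms(3)] by blast
  obtain Sb where Sb: "cmp (K b) (TT * Sb) = TT" "bunit (coef Sb [])"
    using ex_S[OF assms(4)] by blast
  obtain Sb' where Sb': "Sb * Sb' = 1" "Sb' * Sb = 1"
    using ex_inverse[OF Sb(2)] .
  define S where "S = Sb * cmp Sa (Sb' * TT * Sb)"
  have S: "cmp (K (a * b)) (TT * S) = TT"
    unfolding S_def by (rule S_product[OF Sa(1) Sb(1) Sb'])
  \<comment> \<open>Invertibility of \<open>E (a * b)\<close> is read off from the linear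
    coefficient of the equation for \<open>S\<close>: the constant term of \<open>S\<close> is a
    product of two units, and multiplying it by \<open>E (a * b)\<close> gives 1.\<close>
  have "coef (TT * S) [1] = coef S []" by simp
  then have "coef S [] * E (a * b) = 1"
    using arg_cong[OF S, of "\<lambda>F. coef F [1]"]
    by (simp add: coef_cmp lcomp_Cons coef_K_single coef_TT)
  moreover obtain y where "y * (coef Sb [] * coef Sa []) = 1" "coef Sb [] * coef Sa [] * y = 1"
  proof -
    from Sa(2) Sb(2) obtain ya yb where
      "ya * coef Sa [] = 1" "coef Sa [] * ya = 1" "yb * coef Sb [] = 1" "coef Sb [] * yb = 1"
      by (auto simp: bunit_def)
    then show ?thesis using that[of "ya * yb"]
      by (metis mult.assoc mult_1)
  qed
  ultimately have "bunit (E (a * b))"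
    unfolding bunit_def by (simp add: S_def) (metis mult.assoc mult_1 mult_1_right)
  note hats = hat_S_el[OF this S] hat_S_el[OF assms(3) Sa(1)] hat_S_el[OF assms(4) Sb(1)]
  have "hat (minv (S_el lact E b)) = Sb'"
    by (rule hat_minv) (simp_all add: hats Sb')
  then have "seq_eq (S_el lact E (a * b)) (mprod (S_el lact E b)
      (mcomp (S_el lact E a) (mprod (mprod (minv (S_el lact E b)) mI) (S_el lact E b))))"
    by (simp add: seq_eq_iff_hat hat_mprod hat_mcomp hat_mI hats S_def)
  then show ?thesis by (simp only: seq_eq_def)
qed

end
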